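(* Let $k$ be a field of arbitrary characteristic, $B=k^{[3]}$ and $\delta\in\mathrm{EXP}_k(B)$. Let $\{X,Y,Z\}\in\Gamma_\delta(B)$. Then $\delta$ is triangular (over $k$) if and only if $\delta$ is triangular over $k[X]$.
   Context: All rings are commutative with unity. For a domain $A$, $A^{[n]}$ denotes the polynomial ring in $n$ variables over $A$. Exponential map: for domains $A\subset B$, an exponential map on $B$ (over $A$) is an $A$-algebra homomorphism $\delta=\delta_t:B\to B[t]$ ($t$ an indeterminate) such that (1) composing $\delta_t$ with evaluation at $t=0$ gives the identity of $B$, and (2) $\delta_s\circ\delta_t=\delta_{s+t}$, where $\delta_s$ is extended to a homomorphism $B[t]\to B[s,t]$ by $\delta_s(t)=t$. $\mathrm{EXP}_A(B)$ is the set of all of these. The ring of invariants is $B^\delta=\{x\in B:\delta(x)=x\}$. A local slice of $\delta$ is an $x\in B$ such that $\delta(x)$ has minimal positive $t$-degree. Coordinate systems, rank: for $B=A^{[n]}$, a coordinate system of $B$ over $A$ is a system $\{X_1,\dots,X_n\}$ of elements of $B$ (listed in order) with $B=A[X_1,\dots,X_n]$; $\Gamma(B)$ is the set of all coordinate systems. For $\delta\in\mathrm{EXP}_A(B)$, $\mathrm{rank}(\delta)$ is the least integer $r\ge 0$ for which there is $\{X_1,\dots,X_n\}\in\Gamma(B)$ with $A[X_1,\dots,X_{n-r}]\subset B^\delta$. If $\mathrm{rank}(\delta)=r$, $\Gamma_\delta(B)$ is the set of $\{X_1,\dots,X_n\}\in\Gamma(B)$ with $A[X_1,\dots,X_{n-r}]\subset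 B^\delta$. Here $A=k$, $n=3$. Triangular: $\delta$ on $B=A^{[n]}$ is triangular over $A$ if $\delta\in\mathrm{EXP}_A(B)$ and there is a coordinate system $\{X_1,\dots,X_n\}$ of $B$ over $A$ such that (a) $\delta(X_1)-X_1\in tA[t]$; (b) $\delta(X_i)-X_i\in tA[X_1,\dots,X_{i-1}][t]$ for all $i\ge2$; (c) if $i$ is the smallest index with $\delta(X_i)\ne X_i$, then $X_i$ is a local slice of $\delta$. "Triangular over $k[X]$" means triangular over $A=k[X]$ when $B$ is viewed as $k[X]^{[2]}$ (in particular $\delta$ is then a $k[X]$-algebra homomorphism). *)

theory Defs
  imports "HOL-Computational_Algebra.Polynomial"
begin

text \<open>
  The ring \<open>B\<close> is the universe of a type \<open>'b\<close>, its subrings \<open>A\<close> are sets, and \<open>B[t]\<close> is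
  \<^typ>\<open>'b poly\<close>.
\<close>

definition is_subring :: "'b::comm_ring_1 set \<Rightarrow> bool" where
  "is_subring S \<longleftrightarrow>
     1 \<in> S \<and> (\<forall>x\<in>S. \<forall>y\<in>S. x - y \<in> S) \<and> (\<forall>x\<in>S. \<forall>y\<in>S. x * y \<in> S)"

definition adjoin :: "'b::comm_ring_1 set \<Rightarrow> 'b set \<Rightarrow> 'b set" where
  "adjoin A S = is_subring hull (A \<union> S)"

text \<open>
  In the last clause both sides lie in \<open>B[s][t]\<close>, that is \<^typ>\<open>'b poly poly\<close> with outer variable
  \<open>t\<close> and inner variable \<open>s\<close>. On the left, \<open>\<delta>\<^sub>s\<close> is applied to the coefficients of
  \<open>\<delta>\<^sub>t(x)\<close>; on the right, \<open>s + t\<close> is substituted for the variable in \<open>\<delta>(x)\<close>.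
\<close>

definition EXP :: "'b::idom set \<Rightarrow> ('b \<Rightarrow> 'b poly) set" where
  "EXP A = {\<delta>.
     (\<forall>x y. \<delta> (x + y) = \<delta> x + \<delta> y) \<and>
     (\<forall>x y. \<delta> (x * y) = \<delta> x * \<delta> y) \<and>
     (\<forall>a\<in>A. \<delta> a = [:a:]) \<and>
     (\<forall>x. poly (\<delta> x) 0 = x) \<and>
     (\<forall>x. map_poly \<delta> (\<delta> x) = pcompose (map_poly (\<lambda>c. [:c:]) (\<delta> x)) [:[:0, 1:], 1:])}"

definition invariants :: "('b::idom \<Rightarrow> 'b poly) \<Rightarrow> 'b set" where
  "invariants \<delta> = {x. \<delta> x = [:x:]}"

definition local_slice :: "('b::idom \<Rightarrow> 'b poly) \<Rightarrow> 'b \<Rightarrow> bool" where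
  "local_slice \<delta> x \<longleftrightarrow>
     0 < degree (\<delta> x) \<and> (\<forall>y. 0 < degree (\<delta> y) \<longrightarrow> degree (\<delta> x) \<le> degree (\<delta> y))"

text \<open>
  The next four definitions are meant for the case that \<open>B\<close> is a polynomial ring in \<open>n\<close> variables
  over \<open>A\<close>; then any \<open>n\<close> elements generating \<open>B\<close> over \<open>A\<close> are algebraically independent.
\<close>

definition coordinate_systems :: "'b::idom set \<Rightarrow> nat \<Rightarrow> 'b list set" where
  "coordinate_systems A n = {Xs. length Xs = n \<and> adjoin A (set Xs) = UNIV}"

definition rank :: "'b::idom set \<Rightarrow> nat \<Rightarrow> ('b \<Rightarrow> 'b poly) \<Rightarrow> nat" where
  "rank A n \<delta> =
     (LEAST r. r \<le> n \<and>
        (\<exists>Xs\<in>coordinate_systems A n. adjoin A (set (take (n - r) Xs)) \<subseteq> invariants \<delta>))"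

definition adapted_coordinate_systems ::
    "'b::idom set \<Rightarrow> nat \<Rightarrow> ('b \<Rightarrow> 'b poly) \<Rightarrow> 'b list set" where
  "adapted_coordinate_systems A n \<delta> =
     {Xs \<in> coordinate_systems A n.
        adjoin A (set (take (n - rank A n \<delta>) Xs)) \<subseteq> invariants \<delta>}"

definition triangular :: "'b::idom set \<Rightarrow> nat \<Rightarrow> ('b \<Rightarrow> 'b poly) \<Rightarrow> bool" where
  "triangular A n \<delta> \<longleftrightarrow>
     \<delta> \<in> EXP A \<and>
     (\<exists>Xs\<in>coordinate_systems A n.
        (\<forall>i<n. coeff (\<delta> (Xs ! i) - [:Xs ! i:]) 0 = 0 \<and>
           (\<forall>j. coeff (\<delta> (Xs ! i) - [:Xs ! i:]) j \<in> adjoin A (set (take i Xs)))) \<and>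
        (\<forall>i<n. \<delta> (Xs ! i) \<noteq> [:Xs ! i:] \<and> (\<forall>j<i. \<delta> (Xs ! j) = [:Xs ! j:]) \<longrightarrow>
           local_slice \<delta> (Xs ! i)))"

text \<open>
  The polynomial ring in three variables over the field \<open>'k\<close> is \<^typ>\<open>'k poly poly poly\<close>.
\<close>

definition scalars :: "'k::field poly poly poly set" where
  "scalars = range (\<lambda>c. [:[:[:c:]:]:])"

lemma adjoin_closed:
  shows adjoin_base: "a \<in> A \<Longrightarrow> a \<in> adjoin A S"
    and adjoin_gen: "s \<in> S \<Longrightarrow> s \<in> adjoin A S"
    and adjoin_subring: "is_subring (adjoin A S)"
  by (auto simp: adjoin_def hull_def is_subring_def)

lemma subring_add_mult:
  assumes "is_subring S" "x \<in> S" "y \<in> S"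
  shows "x + y \<in> S" "x * y \<in> S"
proof -
  have sub: "u - v \<in> S" if "u \<in> S" "v \<in> S" for u v
    using that assms(1) unfolding is_subring_def by blast
  have "x - ((x - x) - y) \<in> S" using sub assms(2,3) by blast
  then show "x + y \<in> S" by simp
  show "x * y \<in> S" using assms unfolding is_subring_def by blast
qed

lemma standard_coordinate_system:
  "[[:[:[:0, 1:]:]:], [:[:0, 1:]:], [:0, 1:]] \<in>
     coordinate_systems (scalars :: 'k::field poly poly poly set) 3"
proof -
  let ?G = "{[:[:[:0, 1:]:]:], [:[:0, 1:]:], [:0, 1:]} :: 'k poly poly poly set"
  let ?R = "adjoin scalars ?G"
  note cl = subring_add_mult[OF adjoin_subring[of scalars ?G]]
  have gens: "[:[:[:0, 1:]:]:] \<in> ?R" "[:[:0, 1:]:] \<in> ?R" "[:0, 1:] \<in> ?R"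
    by (auto intro: adjoin_gen)
  have c: "[:[:[:a:]:]:] \<in> ?R" for a by (auto intro: adjoin_base simp: scalars_def)
  have 1: "[:[:p:]:] \<in> ?R" for p
  proof (induction p)
    case 0 show ?case using c[of 0] by simp
  next
    case (pCons a p)
    have "[:[:pCons a p:]:] = [:[:[:a:]:]:] + [:[:[:0, 1:]:]:] * [:[:p:]:]" by simp
    then show ?case using cl c gens pCons.IH by metis
  qed
  have 2: "[:q:] \<in> ?R" for q
  proof (induction q)
    case 0 show ?case using c[of 0] by simp
  next
    case (pCons a q)
    have "[:pCons a q:] = [:[:a:]:] + [:[:0, 1:]:] * [:q:]" by simp
    then show ?case using cl 1 gens pCons.IH by metis
  qed
  have 3: "r \<in> ?R" for r
  proof (induction r)
    case 0 show ?case using c[of 0] by simp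
  next
    case (pCons a r)
    have "pCons a r = [:a:] + [:0, 1:] * r" by simp
    then show ?case using cl 2 gens pCons.IH by metis
  qed
  show ?thesis using 3 by (auto simp: coordinate_systems_def)
qed

end

theory Submission
  imports Defs "HOL-Algebra.Algebraic_Closure_Type"
begin

text \<open>
  Only the case of a triangular \<open>\<delta>\<close> over \<open>k\<close>, with coordinates \<open>X1, X2, X3\<close>, needs work. If \<open>\<delta>\<close>
  fixes two coordinates of some system, then it fixes \<open>X\<close> and \<open>Y\<close>, and a degree count gives
  \<open>\<delta>(Z) - Z \<in> k[X, Y][t]\<close>. This happens in particular if \<open>\<delta>(X1) \<noteq> X1\<close>: dividing \<open>\<delta>(X2)\<close> and
  \<open>\<delta>(X3)\<close> by \<open>\<delta>(X1)\<close> yields remainders which are invariant coordinates.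

  Let \<open>X1\<close> be invariant and \<open>X2\<close> a local slice. Division by \<open>\<delta>(X2)\<close> gives an invariant
  \<open>F = c(X1) X3 + U(X1, X2)\<close>, and if the degree of \<open>c\<close> is least, the invariants are \<open>k[X1, F]\<close>. If
  \<open>X \<in> k[X1]\<close>, then \<open>k[X] = k[X1]\<close> and the claim is clear. Otherwise write \<open>X = P(X1, F)\<close> and extend
  scalars from \<open>k[X]\<close> to an algebraic closure \<open>\<Omega>\<close> of \<open>k(X)\<close>: \<open>B\<close> becomes the factorial ring
  \<open>D = \<Omega>[Y, Z]\<close>, with invariants \<open>\<Omega>[X1, F]\<close>. Choose \<open>\<alpha>, \<beta>, r\<close> in \<open>\<Omega>\<close> with \<open>c(\<alpha>) = 0\<close>,
  \<open>P(\<alpha>, \<beta>) = X\<close> and \<open>U(\<alpha>, r) = \<beta>\<close>. A suitable prime factor \<open>q\<close> of \<open>X1 - \<alpha>\<close> also divides \<open>F - \<beta>\<close>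
  and \<open>X2 - r\<close>; being invariant, it lies in \<open>(X1 - \<alpha>, F - \<beta>)\<close>, so that \<open>X2 - r\<close> lies in this ideal
  and \<open>U(\<alpha>, X2) - \<beta>\<close> divides \<open>X2 - r\<close>. Hence \<open>U\<close> is linear in \<open>X2\<close> at all roots of \<open>c\<close>, and by
  Hensel's argument \<open>F\<close> and \<open>X1\<close> belong to a coordinate system, the case already treated.
\<close>

hide_const (open) Polynomials.degree Polynomials.lead_coeff up_ring.coeff up_ring.monom
  module.smult
no_notation Polynomials.var (\<open>X\<index>\<close>)

section \<open>Ring homomorphisms and subrings\<close>

definition rhom :: "('a::comm_ring_1 \<Rightarrow> 'b::comm_ring_1) \<Rightarrow> bool" where
  "rhom h \<longleftrightarrow> h 1 = 1 \<and> (\<forall>x y. h (x + y) = h x + h y) \<and> (\<forall>x y. h (x * y) = h x * h y)"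

lemma rhomI:
  "h 1 = 1 \<Longrightarrow> (\<And>x y. h (x + y) = h x + h y) \<Longrightarrow> (\<And>x y. h (x * y) = h x * h y) \<Longrightarrow> rhom h"
  by (simp add: rhom_def)

lemma rhom_1: "rhom h \<Longrightarrow> h 1 = 1"
  and rhom_add: "rhom h \<Longrightarrow> h (x + y) = h x + h y"
  and rhom_mult: "rhom h \<Longrightarrow> h (x * y) = h x * h y"
  by (auto simp: rhom_def)

lemma rhom_0: "rhom h \<Longrightarrow> h 0 = 0"
  using rhom_add[of h 0 0] by simp

lemma rhom_uminus: "rhom h \<Longrightarrow> h (- x) = - h x"
  using rhom_add[of h x "- x"] rhom_0[of h] by (simp add: eq_neg_iff_add_eq_0 add.commute)

lemma rhom_diff: "rhom h \<Longrightarrow> h (x - y) = h x - h y"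
  using rhom_add[of h x "- y"] by (simp add: rhom_uminus)

lemma rhom_sum: "rhom h \<Longrightarrow> h (sum f A) = (\<Sum>a\<in>A. h (f a))"
  by (induction A rule: infinite_finite_induct) (auto simp: rhom_0 rhom_add)

lemma rhom_power: "rhom h \<Longrightarrow> h (x ^ n) = h x ^ n"
  by (induction n) (auto simp: rhom_1 rhom_mult)

lemmas rhom_simps = rhom_0 rhom_1 rhom_add rhom_mult rhom_uminus rhom_diff rhom_power

lemma rhom_comp: "rhom f \<Longrightarrow> rhom g \<Longrightarrow> rhom (\<lambda>x. f (g x))"
  by (simp add: rhom_def)

lemma rhom_const: "rhom (\<lambda>a. [:a:])"
  by (rule rhomI) auto

lemma rhom_poly: "rhom (\<lambda>p. poly p x)"
  by (rule rhomI) auto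

lemma rhom_pcompose: "rhom (\<lambda>p. pcompose p q)"
  by (rule rhomI) (auto simp: pcompose_add pcompose_mult pcompose_1)

lemma rhom_map_poly:
  assumes "rhom h"
  shows "rhom (map_poly h)"
proof (rule rhomI)
  show "map_poly h (p * q) = map_poly h p * map_poly h q" for p q
    by (intro poly_eqI)
      (simp add: coeff_map_poly rhom_simps[OF assms] coeff_mult rhom_sum[OF assms])
qed (auto intro!: poly_eqI simp: coeff_map_poly rhom_simps[OF assms])

lemma rhom_map_poly_eval: "rhom h \<Longrightarrow> rhom (\<lambda>p. poly (map_poly h p) x)"
  by (intro rhom_comp[OF rhom_poly] rhom_map_poly)

lemma rhom_inv:
  assumes "rhom h" "bij h"
  shows "rhom (inv_into UNIV h)"
proof (rule rhomI)
  have hi: "h (inv_into UNIV h y) = y" and ih: "inv_into UNIV h (h x) = x" for x y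
    using assms(2) by (auto simp: bij_def surj_f_inv_f)
  show "inv_into UNIV h 1 = 1" using ih[of 1] rhom_1[OF assms(1)] by simp
  show "inv_into UNIV h (x + y) = inv_into UNIV h x + inv_into UNIV h y" for x y
    using ih[of "inv_into UNIV h x + inv_into UNIV h y"] by (simp add: rhom_simps[OF assms(1)] hi)
  show "inv_into UNIV h (x * y) = inv_into UNIV h x * inv_into UNIV h y" for x y
    using ih[of "inv_into UNIV h x * inv_into UNIV h y"] by (simp add: rhom_simps[OF assms(1)] hi)
qed

lemma map_poly_rhom_comp:
  "rhom f \<Longrightarrow> rhom g \<Longrightarrow> map_poly f (map_poly g p) = map_poly (\<lambda>x. f (g x)) p"
  by (subst map_poly_map_poly) (auto simp: rhom_0 comp_def)

lemma degree_map_poly_inj: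
  assumes "rhom h" "inj h"
  shows "degree (map_poly h p) = degree p"
  using assms by (intro degree_map_poly) (metis injD rhom_0)

lemma inj_map_poly:
  assumes "rhom h" "inj h"
  shows "inj (map_poly h)"
proof (rule injI)
  fix p q assume "map_poly h p = map_poly h q"
  then have "h (coeff p n) = h (coeff q n)" for n
    using coeff_map_poly[of h, OF rhom_0[OF assms(1)]] by metis
  then show "p = q" using assms(2) by (intro poly_eqI) (auto dest: injD)
qed

lemma rhom_of_poly:
  assumes "rhom h" "rhom g"
  shows "h (poly (map_poly g p) x) = poly (map_poly (\<lambda>a. h (g a)) p) (h x)"
  by (induction p)
    (auto simp: map_poly_pCons rhom_simps[OF assms(1)] rhom_simps[OF assms(2)])

lemma rhom_poly_eq: "rhom h \<Longrightarrow> h (poly p x) = poly (map_poly h p) (h x)"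
  by (induction p) (auto simp: map_poly_pCons rhom_simps)

lemma subring_0: "is_subring S \<Longrightarrow> 0 \<in> S"
  unfolding is_subring_def by (metis diff_self)

lemma subring_1: "is_subring S \<Longrightarrow> 1 \<in> S"
  and subring_diff: "is_subring S \<Longrightarrow> x \<in> S \<Longrightarrow> y \<in> S \<Longrightarrow> x - y \<in> S"
  unfolding is_subring_def by blast+

lemmas subring_add = subring_add_mult(1) and subring_mult = subring_add_mult(2)

lemma subring_uminus: "is_subring S \<Longrightarrow> x \<in> S \<Longrightarrow> - x \<in> S"
  using subring_diff[of S 0 x] by (simp add: subring_0)

lemma subring_power: "is_subring S \<Longrightarrow> x \<in> S \<Longrightarrow> x ^ n \<in> S"
  by (induction n) (auto intro: subring_1 subring_mult)

lemma subring_sum: "is_subring S \<Longrightarrow> (\<And>i. i \<in> I \<Longrightarrow> f i \<in> S) \<Longrightarrow> sum f I \<in> S"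
  by (induction I rule: infinite_finite_induct) (auto intro: subring_0 subring_add)

lemma subring_poly:
  assumes "is_subring S" "\<And>i. coeff p i \<in> S" "x \<in> S"
  shows "poly p x \<in> S"
  using assms(2)
proof (induction p)
  case (pCons a p)
  from pCons.prems[of 0] have "a \<in> S" by simp
  moreover have "coeff p i \<in> S" for i using pCons.prems[of "Suc i"] by simp
  ultimately show ?case using pCons.IH assms by (auto intro: subring_add subring_mult)
qed (auto intro: subring_0 assms)

lemmas subring_intros = subring_0 subring_1 subring_add subring_mult subring_diff
  subring_uminus subring_power

lemma adjoin_least: "is_subring S \<Longrightarrow> A \<subseteq> S \<Longrightarrow> G \<subseteq> S \<Longrightarrow> adjoin A G \<subseteq> S"
  unfolding adjoin_def by (rule hull_minimal) auto

lemma subring_equalizer: "rhom f \<Longrightarrow> rhom g \<Longrightarrow> is_subring {x. f x = g x}"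
  by (auto simp: is_subring_def rhom_simps)

lemma subring_vimage: "rhom f \<Longrightarrow> is_subring S \<Longrightarrow> is_subring {x. f x \<in> S}"
  by (auto simp: is_subring_def rhom_simps)

lemma subring_range: "rhom f \<Longrightarrow> is_subring (range f)"
  unfolding is_subring_def
  by (auto simp: rhom_diff[symmetric] rhom_mult[symmetric]) (metis rhom_1 rangeI)

lemma rhom_eqI:
  assumes "rhom f" "rhom g" "adjoin A G = UNIV"
    and "\<And>a. a \<in> A \<Longrightarrow> f a = g a" "\<And>a. a \<in> G \<Longrightarrow> f a = g a"
  shows "f x = g x"
proof -
  have "adjoin A G \<subseteq> {x. f x = g x}"
    by (intro adjoin_least subring_equalizer) (use assms in auto)
  then show ?thesis using assms(3) by auto
qed

lemma subring_poly_coeffs: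
  assumes "is_subring S"
  shows "is_subring {p. \<forall>i. coeff p i \<in> S}"
  unfolding is_subring_def
proof (intro conjI ballI)
  fix p q assume "p \<in> {p. \<forall>i. coeff p i \<in> S}" "q \<in> {p. \<forall>i. coeff p i \<in> S}"
  moreover from this have "(\<Sum>i\<in>I. coeff p i * coeff q (n - i)) \<in> S" for n and I :: "nat set"
    by (induction I rule: infinite_finite_induct) (use assms in \<open>auto intro: subring_intros\<close>)
  ultimately show "p * q \<in> {p. \<forall>i. coeff p i \<in> S}" by (simp add: coeff_mult)
qed (use assms in \<open>auto intro: subring_diff simp: subring_0 subring_1 coeff_1\<close>)

section \<open>Noetherian rings\<close>

definition is_ideal :: "'a::comm_ring_1 set \<Rightarrow> bool" where
  "is_ideal I \<longleftrightarrow> 0 \<in> I \<and> (\<forall>x\<in>I. \<forall>y\<in>I. x + y \<in> I) \<and> (\<forall>r. \<forall>x\<in>I. r * x \<in> I)"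

lemma ideal_0: "is_ideal I \<Longrightarrow> 0 \<in> I"
  and ideal_add: "is_ideal I \<Longrightarrow> x \<in> I \<Longrightarrow> y \<in> I \<Longrightarrow> x + y \<in> I"
  and ideal_mult: "is_ideal I \<Longrightarrow> x \<in> I \<Longrightarrow> r * x \<in> I"
  by (auto simp: is_ideal_def)

lemma ideal_diff: "is_ideal I \<Longrightarrow> x \<in> I \<Longrightarrow> y \<in> I \<Longrightarrow> x - y \<in> I"
proof -
  assume "is_ideal I" "x \<in> I" "y \<in> I"
  then have "x + (- 1) * y \<in> I" unfolding is_ideal_def by blast
  then show ?thesis by simp
qed

definition ascending_chain_condition :: "'a::comm_ring_1 itself \<Rightarrow> bool" where
  "ascending_chain_condition _ \<longleftrightarrow>
     (\<forall>I :: nat \<Rightarrow> 'a set. (\<forall>n. is_ideal (I n)) \<longrightarrow> incseq I \<longrightarrow> (\<exists>N. \<forall>n\<ge>N. I n = I N))"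

lemma ascending_chain_condition_field: "ascending_chain_condition TYPE('a::field)"
  unfolding ascending_chain_condition_def
proof (intro allI impI)
  fix I :: "nat \<Rightarrow> 'a set"
  assume id: "\<forall>n. is_ideal (I n)" and inc: "incseq I"
  show "\<exists>N. \<forall>n\<ge>N. I n = I N"
  proof (cases "\<exists>N. \<exists>x\<in>I N. x \<noteq> 0")
    case True
    then obtain N x where x: "x \<in> I N" "x \<noteq> 0" by blast
    have "y \<in> I n" if "n \<ge> N" for n y
    proof -
      have "x \<in> I n" using x inc that by (auto simp: incseq_def)
      moreover have "y = (y / x) * x" using x by simp
      ultimately show ?thesis using id unfolding is_ideal_def by metis
    qed
    then show ?thesis by blast
  next
    case False
    then have "I n = {0}" for n using id unfolding is_ideal_def by auto
    then show ?thesis by simp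
  qed
qed

text \<open>Hilbert's basis theorem, by comparing the ideals of coefficients of degree \<open>d\<close>.\<close>

lemma ascending_chain_condition_poly:
  assumes "ascending_chain_condition TYPE('a::comm_ring_1)"
  shows "ascending_chain_condition TYPE('a poly)"
  unfolding ascending_chain_condition_def
proof (intro allI impI)
  fix I :: "nat \<Rightarrow> 'a poly set"
  assume "\<forall>n. is_ideal (I n)" and inc: "incseq I"
  then have id: "is_ideal (I n)" for n by blast
  define L where "L n d = {coeff f d |f. f \<in> I n \<and> degree f \<le> d}" for n d
  have L_ideal: "is_ideal (L n d)" for n d
    unfolding is_ideal_def
  proof (intro conjI ballI allI)
    show "0 \<in> L n d" unfolding L_def using ideal_0[OF id] by (auto intro!: exI[of _ 0])
    fix x assume "x \<in> L n d"
    then obtain f where f: "f \<in> I n" "degree f \<le> d" "x = coeff f d" by (auto simp: L_def)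
    show "r * x \<in> L n d" for r
    proof -
      have "[:r:] * f \<in> I n" by (rule ideal_mult[OF id f(1)])
      moreover have "degree ([:r:] * f) \<le> d" using f(2) degree_smult_le[of r f] by simp
      ultimately show ?thesis using f(3) unfolding L_def by (intro CollectI exI[of _ "[:r:] * f"]) auto
    qed
    fix y assume "y \<in> L n d"
    then obtain g where g: "g \<in> I n" "degree g \<le> d" "y = coeff g d" by (auto simp: L_def)
    have "f + g \<in> I n" by (rule ideal_add[OF id f(1) g(1)])
    then show "x + y \<in> L n d" using f g unfolding L_def
      by (intro CollectI exI[of _ "f + g"]) (auto intro: degree_add_le)
  qed
  have L_mono: "L n d \<subseteq> L m e" if "n \<le> m" "d \<le> e" for n d m e
  proof
    fix x assume "x \<in> L n d"
    then obtain f where f: "f \<in> I n" "degree f \<le> d" "x = coeff f d" by (auto simp: L_def)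
    let ?g = "monom 1 (e - d) * f"
    have "f \<in> I m" using inc that f(1) by (auto simp: incseq_def)
    then have "?g \<in> I m" by (rule ideal_mult[OF id])
    moreover have "degree ?g \<le> e"
      using degree_mult_le[of "monom 1 (e - d)" f] degree_monom_le[of "1::'a" "e - d"] f(2) that by linarith
    moreover have "coeff ?g e = x" using that f(3) by (simp add: coeff_monom_mult)
    ultimately show "x \<in> L m e" unfolding L_def by blast
  qed
  have stab: "\<exists>N. \<forall>n\<ge>N. J n = J N" if "\<And>n. is_ideal (J n)" "incseq J" for J :: "nat \<Rightarrow> 'a set"
    using assms that unfolding ascending_chain_condition_def by blast
  \<comment> \<open>The diagonal chain controls all degrees \<open>d \<ge> N\<close> at once; only
    the finitely many smaller degrees need thresholds of their own.\<close>
  obtain N where N: "\<And>n. n \<ge> N \<Longrightarrow> L n n = L N N"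
  proof -
    have "incseq (\<lambda>n. L n n)" unfolding incseq_def using L_mono by blast
    from stab[OF L_ideal this] show ?thesis using that by blast
  qed
  have "\<exists>M. \<forall>n\<ge>M. L n d = L M d" for d
  proof -
    have "incseq (\<lambda>n. L n d)" unfolding incseq_def using L_mono by blast
    from stab[OF L_ideal this] show ?thesis .
  qed
  then obtain M where M: "\<And>d n. n \<ge> M d \<Longrightarrow> L n d = L (M d) d" by metis
  define K where "K = N + (\<Sum>d<N. M d)"
  have K: "L n d = L K d" if "n \<ge> K" for n d
  proof (cases "d < N")
    case True
    then have "M d \<le> (\<Sum>d<N. M d)" by (intro member_le_sum) auto
    then have "M d \<le> K" by (simp add: K_def)
    then show ?thesis using M[of d n] M[of d K] that by simp
  next
    case False
    have "L m d = L N N" if "m \<ge> N" for m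
    proof
      show "L m d \<subseteq> L N N" using L_mono[of m "max m d" d "max m d"] N[of "max m d"] that by auto
      show "L N N \<subseteq> L m d" using L_mono[of N m N d] that False by auto
    qed
    then show ?thesis using that by (simp add: K_def)
  qed
  have "f \<in> I K" if "n \<ge> K" "f \<in> I n" "degree f < d" for n f d
    using that(2,3)
  proof (induction d arbitrary: f)
    case (Suc d)
    then have "coeff f d \<in> L n d" unfolding L_def by auto
    then have "coeff f d \<in> L K d" using K[OF that(1)] by simp
    then obtain g where g: "g \<in> I K" "degree g \<le> d" "coeff f d = coeff g d" unfolding L_def by auto
    have "g \<in> I n" using g(1) inc that(1) by (auto simp: incseq_def)
    then have fg: "f - g \<in> I n" using ideal_diff[OF id] Suc.prems by blast
    have fgK: "f - g \<in> I K"
    proof (cases "f - g = 0")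
      case True then show ?thesis using ideal_0[OF id] by simp
    next
      case False
      have "degree (f - g) \<le> d" using Suc.prems g(2) by (intro degree_diff_le) auto
      moreover have "degree (f - g) \<noteq> d"
        using g(3) False by (metis coeff_diff diff_self leading_coeff_0_iff)
      ultimately show ?thesis using Suc.IH[OF fg] by simp
    qed
    have "f = (f - g) + g" by simp
    then show ?case using ideal_add[OF id fgK g(1)] by simp
  qed simp
  then have "I n \<subseteq> I K" if "n \<ge> K" for n using that by blast
  moreover have "I K \<subseteq> I n" if "n \<ge> K" for n using that inc by (simp add: incseq_def)
  ultimately show "\<exists>N. \<forall>n\<ge>N. I n = I N" by (intro exI[of _ K] allI impI equalityI)
qed

text \<open>The kernels of the iterates \<open>h ^^ n\<close> form an ascending chain. If it is
  constant from \<open>N\<close> on and \<open>h x = 0\<close>, write \<open>x = (h ^^ N) y\<close>: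
  then \<open>y\<close> lies in the kernel of \<open>h ^^ Suc N\<close>, hence in that of
  \<open>h ^^ N\<close>, and \<open>x = 0\<close>.\<close>

lemma surj_endomorphism_inj:
  assumes "ascending_chain_condition TYPE('a::comm_ring_1)" and h: "rhom (h :: 'a \<Rightarrow> 'a)" "surj h"
  shows "inj h"
proof -
  have hn: "rhom (h ^^ n)" "surj (h ^^ n)" for n
  proof (induction n)
    case (Suc n)
    show "rhom (h ^^ Suc n)" using rhom_comp[OF h(1) Suc(1)] by (simp add: comp_def)
    show "surj (h ^^ Suc n)" unfolding funpow.simps by (rule comp_surj[OF Suc(2) h(2)])
  qed (auto simp: rhom_def)
  define I where "I n = {x. (h ^^ n) x = 0}" for n
  have "\<forall>n. is_ideal (I n)" unfolding I_def is_ideal_def by (auto simp: rhom_simps[OF hn(1)])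
  moreover have "incseq I" by (rule incseq_SucI) (auto simp: I_def rhom_0[OF h(1)])
  ultimately obtain N where N: "\<And>n. n \<ge> N \<Longrightarrow> I n = I N"
    using assms(1) unfolding ascending_chain_condition_def by blast
  have ker: "x = 0" if "h x = 0" for x
  proof -
    obtain y where y: "x = (h ^^ N) y" using surjD[OF hn(2)] by blast
    then have "y \<in> I (Suc N)" using that by (simp add: I_def)
    then have "y \<in> I N" using N[of "Suc N"] by simp
    then show ?thesis using y by (simp add: I_def)
  qed
  show ?thesis
  proof (rule injI)
    fix x y assume "h x = h y"
    then have "h (x - y) = 0" by (simp add: rhom_diff[OF h(1)])
    then have "x - y = 0" by (rule ker)
    then show "x = y" by simp
  qed
qed

section \<open>Coordinate systems as automorphisms of the polynomial ring\<close>

definition const3 :: "'k::field \<Rightarrow> 'k poly poly poly" where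
  "const3 c = [:[:[:c:]:]:]"

text \<open>The substitution homomorphism out of \<open>k[x1, x2, x3]\<close>, with
  \<open>x1\<close> as the innermost variable; \<open>h\<close> acts on the constants.\<close>

definition eval3 :: "('k::field \<Rightarrow> 'b::comm_ring_1) \<Rightarrow> 'b \<Rightarrow> 'b \<Rightarrow> 'b \<Rightarrow> 'k poly poly poly \<Rightarrow> 'b" where
  "eval3 h u v w f =
     poly (map_poly (\<lambda>g. poly (map_poly (\<lambda>p. poly (map_poly h p) u) g) v) f) w"

abbreviation "x1 \<equiv> [:[:[:0, 1:]:]:]"
abbreviation "x2 \<equiv> [:[:0, 1:]:]"
abbreviation "x3 \<equiv> [:0, 1:]"

lemma scalars_const3: "scalars = range const3"
  by (auto simp: scalars_def const3_def)

lemma rhom_const3: "rhom const3"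
  unfolding const3_def by (intro rhomI) (auto simp: one_pCons)

lemma rhom_eval3: "rhom h \<Longrightarrow> rhom (eval3 h u v w)"
  unfolding eval3_def[abs_def] by (intro rhom_map_poly_eval)

lemma eval3_simps:
  assumes "rhom h"
  shows "eval3 h u v w (const3 c) = h c" "eval3 h u v w x1 = u"
    "eval3 h u v w x2 = v" "eval3 h u v w x3 = w"
    "eval3 h u v w [:[:[:c:]:]:] = h c"
  by (simp_all add: eval3_def const3_def map_poly_pCons rhom_simps[OF assms]
      map_poly_1' one_pCons[symmetric])

lemma adjoin_standard: "adjoin scalars {x1, x2, x3 :: 'k::field poly poly poly} = UNIV"
  using standard_coordinate_system[where 'k='k] by (simp add: coordinate_systems_def)

text \<open>Generators make the substitution endomorphism surjective, and a surjective endomorphism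
  of a Noetherian ring is injective. Hence three generators of \<open>B\<close> are algebraically
  independent.\<close>

lemma bij_eval3:
  assumes "adjoin scalars {u, v, w :: 'k::field poly poly poly} = UNIV"
  shows "bij (eval3 const3 u v w)"
proof -
  let ?e = "eval3 const3 u v w"
  have r: "rhom ?e" by (intro rhom_eval3 rhom_const3)
  have "adjoin scalars {u, v, w} \<subseteq> range ?e"
  proof (rule adjoin_least[OF subring_range[OF r]])
    have "const3 c \<in> range ?e" for c
      using rangeI[of ?e "const3 c"] by (simp only: eval3_simps(1)[OF rhom_const3])
    then show "scalars \<subseteq> range ?e" unfolding scalars_const3 by blast
    show "{u, v, w} \<subseteq> range ?e"
      using rangeI[of ?e x1] rangeI[of ?e x2] rangeI[of ?e x3]
      unfolding eval3_simps(2-4)[OF rhom_const3] by blast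
  qed
  then have "surj ?e" using assms by auto
  moreover from this have "inj ?e"
    by (intro surj_endomorphism_inj[OF _ r] ascending_chain_condition_poly
        ascending_chain_condition_field)
  ultimately show ?thesis by (simp add: bij_def)
qed

section \<open>Local slices\<close>

text \<open>This is \<open>p(s + t)\<close> in \<open>B[s][t]\<close>; for
  \<open>p = \<delta> x\<close> it is the right-hand side of the action law in
  \<open>EXP\<close>.\<close>

definition shift :: "'b::idom poly \<Rightarrow> 'b poly poly" where
  "shift p = pcompose (map_poly (\<lambda>c. [:c:]) p) [:[:0, 1:], 1:]"

lemma rhom_shift: "rhom shift"
  unfolding shift_def[abs_def] by (intro rhom_comp[OF rhom_pcompose] rhom_map_poly rhom_const)

lemma degree_shift: "degree (shift p) = degree p"
  unfolding shift_def
  by (simp add: degree_pcompose degree_map_poly_inj[OF rhom_const] inj_def)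

lemma poly_shift_0: "poly (shift p) 0 = p"
  using pcompose_altdef[of p "[:0, 1:]"] by (simp add: shift_def poly_pcompose)

lemma shift_pCons: "shift (pCons a p) = [:[:a:]:] + [:[:0, 1:], 1:] * shift p"
  by (simp add: shift_def map_poly_pCons pcompose_pCons)

text \<open>Every monomial of \<open>p(s + t)\<close> has total degree at most
  \<open>degree p\<close>, and the coefficient of \<open>t^i\<close> is a polynomial in
  \<open>s\<close>.\<close>

lemma degree_coeff_shift:
  "coeff (shift p) i \<noteq> 0 \<Longrightarrow> i + degree (coeff (shift p) i) \<le> degree p"
proof (induction p arbitrary: i)
  case 0
  then show ?case by (simp add: rhom_0[OF rhom_shift])
next
  case (pCons a p)
  show ?case
  proof (cases "p = 0")
    case True
    then show ?thesis using pCons.prems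
      by (cases i) (auto simp: shift_pCons rhom_0[OF rhom_shift])
  next
    case False
    \<comment> \<open>The two contributions come from the factor \<open>s + t\<close>:
      \<open>u\<close> from \<open>t\<close>, with the new constant term at \<open>i = 0\<close>,
      and \<open>v\<close> from \<open>s\<close>.\<close>
    define u where "u = (if i = 0 then [:a:] else coeff (shift p) (i - 1))"
    define v where "v = [:0, 1:] * coeff (shift p) i"
    have c: "coeff (shift (pCons a p)) i = u + v"
      by (cases i) (auto simp: shift_pCons u_def v_def)
    have "u \<noteq> 0 \<Longrightarrow> i + degree u \<le> Suc (degree p)"
      using pCons.IH[of "i - 1"] by (cases i) (auto simp: u_def)
    moreover have "v \<noteq> 0 \<Longrightarrow> i + degree v \<le> Suc (degree p)"
      using pCons.IH[of i] unfolding v_def by (subst degree_mult_eq) auto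
    moreover have "u \<noteq> 0 \<or> v \<noteq> 0" using c pCons.prems by auto
    ultimately have "i + degree (u + v) \<le> Suc (degree p)"
      using degree_add_le_max[of u v] by (cases "u = 0"; cases "v = 0") auto
    then show ?thesis using False c by simp
  qed
qed

text \<open>Multiplying by the leading coefficient of \<open>h\<close> before each reduction avoids
  division, so quotient and remainder keep their coefficients in \<open>S\<close>.\<close>

lemma pseudo_division_subring:
  fixes g h :: "'b::idom poly"
  assumes S: "is_subring S" and h: "\<And>i. coeff h i \<in> S" "degree h > 0"
    and g: "\<And>i. coeff g i \<in> S"
  shows "\<exists>N q r. (\<forall>i. coeff q i \<in> S) \<and> (\<forall>i. coeff r i \<in> S) \<and>
    smult (lead_coeff h ^ N) g = q * h + r \<and> degree r < degree h"
  using g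
proof (induction "degree g" arbitrary: g rule: less_induct)
  case less
  note Sp = subring_poly_coeffs[OF S]
  show ?case
  proof (cases "degree g < degree h")
    case True
    then show ?thesis using less.prems subring_0[OF S]
      by (intro exI[of _ 0] exI[of _ "0 :: 'b poly"] exI[of _ g]) auto
  next
    case False
    define m where "m = monom (lead_coeff g) (degree g - degree h)"
    define g' where "g' = smult (lead_coeff h) g - m * h"
    have mS: "m \<in> {p. \<forall>i. coeff p i \<in> S}" unfolding m_def using less.prems subring_0[OF S] by auto
    moreover have "m * h \<in> {p. \<forall>i. coeff p i \<in> S}"
      by (rule subring_mult[OF Sp mS]) (use h in auto)
    ultimately have gS: "coeff g' i \<in> S" for i unfolding g'_def
      using less.prems h by (auto intro!: subring_intros S)
    have deg: "degree g' < degree g"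
    proof -
      have "degree (m * h) \<le> degree g"
        using degree_mult_le[of m h] degree_monom_le[of "lead_coeff g" "degree g - degree h"] False
        unfolding m_def by linarith
      then have "degree g' \<le> degree g" unfolding g'_def
        by (intro degree_diff_le degree_smult_le) auto
      moreover have "coeff g' (degree g) = 0"
        using False by (simp add: g'_def m_def coeff_monom_mult)
      ultimately show ?thesis
        using False h(2) by (metis degree_0 leading_coeff_0_iff le_neq_implies_less less_le_trans not_less)
    qed
    obtain N q r where *: "\<forall>i. coeff q i \<in> S" "\<forall>i. coeff r i \<in> S"
      "smult (lead_coeff h ^ N) g' = q * h + r" "degree r < degree h"
      using less.hyps[OF deg gS] by blast
    have "smult (lead_coeff h ^ Suc N) g = (q + smult (lead_coeff h ^ N) m) * h + r"
      using *(3) by (simp add: g'_def smult_diff_right algebra_simps)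
    moreover have "\<forall>i. coeff (q + smult (lead_coeff h ^ N) m) i \<in> S"
      using *(1) mS h by (auto intro!: subring_intros S)
    ultimately show ?thesis using *(2,4) by blast
  qed
qed

locale exponential =
  fixes \<delta> :: "'b::idom \<Rightarrow> 'b poly"
  assumes rhom: "rhom \<delta>"
    and poly_0: "poly (\<delta> x) 0 = x"
    and action: "map_poly \<delta> (\<delta> x) = shift (\<delta> x)"
begin

lemma coeff_0: "coeff (\<delta> x) 0 = x"
  using poly_0[of x] by (simp add: poly_0_coeff_0)

lemma subring_invariants: "is_subring (invariants \<delta>)"
  unfolding invariants_def by (rule subring_equalizer[OF rhom rhom_const])

lemma invariant_iff: "x \<in> invariants \<delta> \<longleftrightarrow> degree (\<delta> x) = 0"
  using coeff_0[of x] by (auto simp: invariants_def elim!: degree_eq_zeroE)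

text \<open>Division of \<open>\<delta>(y)\<close> by \<open>\<delta>(x)\<close> commutes with the action, so the remainder, whose \<open>t\<close>-degree is
  smaller than that of the local slice, has invariant coefficients and is itself constant.\<close>

lemma slice_invariant:
  assumes x: "local_slice \<delta> x" and S: "is_subring S" and xS: "\<And>i. coeff (\<delta> x) i \<in> S"
    and inv: "lead_coeff (\<delta> x) \<in> invariants \<delta>"
    and yS: "\<And>i. coeff (\<delta> y - [:y:]) i \<in> S"
  shows "\<exists>N. \<exists>s\<in>S. lead_coeff (\<delta> x) ^ N * y + s \<in> invariants \<delta>"
proof -
  let ?h = "\<delta> x" and ?M = "map_poly \<delta>"
  have M: "rhom ?M" by (rule rhom_map_poly[OF rhom])
  have n: "degree ?h > 0" using x by (simp add: local_slice_def)
  \<comment> \<open>The division is made for \<open>\<delta> y - [:y:]\<close>, whose coefficients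
    lie in \<open>S\<close> although \<open>y\<close> need not; the missing constant is put back in
    \<open>r\<close>.\<close>
  obtain N q r' where *: "\<forall>i. coeff r' i \<in> S"
    "smult (lead_coeff ?h ^ N) (\<delta> y - [:y:]) = q * ?h + r'" "degree r' < degree ?h"
    using pseudo_division_subring[OF S xS n yS] by blast
  define c where "c = lead_coeff ?h ^ N"
  define r where "r = r' + [:c * y:]"
  have c: "\<delta> c = [:c:]"
    using subring_power[OF subring_invariants inv, of N] by (simp add: c_def invariants_def)
  have div: "[:c:] * \<delta> y = q * ?h + r" using *(2) by (simp add: c_def r_def algebra_simps smult_diff_right)
  have r: "degree r < degree ?h" using *(3) n unfolding r_def by (auto intro: degree_add_less)
  have Mc: "?M [:c:] = shift [:c:]"
    by (simp add: map_poly_pCons rhom_0[OF rhom] c shift_pCons rhom_0[OF rhom_shift])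
  have "?M q * shift ?h + ?M r = shift q * shift ?h + shift r"
    using arg_cong[OF div, of ?M] arg_cong[OF div, of shift]
    by (simp add: rhom_simps[OF M] rhom_simps[OF rhom_shift] action Mc del: mult_pCons_left)
  then have eq: "(?M q - shift q) * shift ?h = shift r - ?M r" by (simp add: algebra_simps)
  have "degree (shift r - ?M r) < degree ?h"
    using r degree_shift[of r] map_poly_degree_leq[of \<delta> r]
    by (intro degree_diff_less) auto
  then have "?M q - shift q = 0"
    using eq degree_shift[of ?h] degree_mult_eq[of "?M q - shift q" "shift ?h"] n by fastforce
  then have rr: "?M r = shift r" using eq by simp
  have inv_r: "coeff r i \<in> invariants \<delta>" for i
  proof (rule ccontr)
    assume "coeff r i \<notin> invariants \<delta>"
    then have "degree (\<delta> (coeff r i)) > 0" by (simp add: invariant_iff)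
    then have "degree ?h \<le> degree (\<delta> (coeff r i))" using x by (simp add: local_slice_def)
    moreover have "\<delta> (coeff r i) = coeff (shift r) i"
      using rr by (metis coeff_map_poly rhom_0 rhom)
    ultimately show False using degree_coeff_shift[of r i] r n
      by (metis add_leD2 degree_0 le_trans not_less)
  qed
  have "?M r = map_poly (\<lambda>c. [:c:]) r"
    using inv_r by (intro poly_eqI) (simp add: coeff_map_poly rhom_0[OF rhom] invariants_def)
  \<comment> \<open>Invariant coefficients make \<open>shift r\<close> equal to \<open>r(t)\<close>;
    at \<open>t = 0\<close> this reads \<open>r(s) = r(0)\<close>.\<close>
  then have "r = [:coeff r 0:]"
    using rr poly_shift_0[of r] by (simp add: poly_0_coeff_0 coeff_map_poly)
  then have "coeff r 0 = lead_coeff ?h ^ N * y + coeff r' 0" by (simp add: r_def c_def)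
  then show ?thesis using inv_r[of 0] *(1) by (intro exI[of _ N] bexI[of _ "coeff r' 0"]) auto
qed

end

lemma EXP_exponential:
  assumes "\<delta> \<in> EXP A" "1 \<in> A"
  shows "exponential \<delta>"
proof
  show "rhom \<delta>" using assms unfolding EXP_def by (intro rhomI) (auto simp: one_pCons)
qed (use assms in \<open>auto simp: EXP_def shift_def\<close>)

section \<open>Polynomials that are linear on fibres\<close>

text \<open>The cofactor is built from \<open>y\<close>, \<open>z\<close> and the coefficients
  alone. That it stays in \<open>S\<close> matters when \<open>x3\<close> is recovered inside a
  generated subring.\<close>

lemma poly_diff_factor_subring:
  assumes "is_subring S" "\<And>i. coeff P i \<in> S" "y \<in> S" "z \<in> S"
  shows "\<exists>s\<in>S. poly P y - poly P z = (y - z) * s"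
  using assms(2)
proof (induction P)
  case 0
  then show ?case using subring_0[OF assms(1)] by (intro bexI[of _ 0]) auto
next
  case (pCons a P)
  have P: "coeff P i \<in> S" for i using pCons.prems[of "Suc i"] by simp
  then obtain s where s: "s \<in> S" "poly P y - poly P z = (y - z) * s" using pCons.IH by blast
  have "poly (pCons a P) y - poly (pCons a P) z = (y - z) * poly P y + z * (poly P y - poly P z)"
    by (simp add: algebra_simps)
  also have "\<dots> = (y - z) * (poly P y + z * s)" unfolding s(2) by (simp add: algebra_simps)
  finally show ?case using s(1) assms P
    by (intro bexI[of _ "poly P y + z * s"]) (auto intro!: subring_intros subring_poly)
qed

lemma poly_diff_dvd: "y - z dvd poly P y - poly P (z :: 'a::comm_ring_1)"
  using poly_diff_factor_subring[of UNIV P y z] by (auto simp: is_subring_def)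

text \<open>Newton iteration: modulo \<open>e\<close> the polynomial \<open>P\<close> is linear with
  slope \<open>u1\<close>, whose inverse is \<open>a\<close>, so the correction
  \<open>- a * (e ^ j * d)\<close> gains a factor \<open>e\<close>.\<close>

lemma hensel_surjective:
  fixes a e m u0 u1 z :: "'a::comm_ring_1"
  assumes au: "a * u1 + m * e = 1" and P: "P = [:u0, u1:] + smult e N"
  shows "\<exists>y. e ^ j dvd poly P y - z"
proof (induction j)
  case (Suc j)
  then obtain y d where d: "poly P y - z = e ^ j * d" unfolding dvd_def by blast
  define y' where "y' = y - a * (e ^ j * d)"
  obtain s where s: "poly N y' - poly N y = (y' - y) * s" using poly_diff_dvd[of y' y N] unfolding dvd_def by blast
  have y'y: "y' - y = - (a * (e ^ j * d))" by (simp add: y'_def)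
  have "poly P y' - z = (poly P y - z) + u1 * (y' - y) + e * (poly N y' - poly N y)"
    unfolding P by (simp add: algebra_simps)
  also have "\<dots> = e ^ j * d * (1 - a * u1) - e * (a * (e ^ j * d) * s)"
    unfolding s d y'y by (simp add: algebra_simps)
  also have "1 - a * u1 = m * e" using au by (simp add: algebra_simps)
  also have "e ^ j * d * (m * e) - e * (a * (e ^ j * d) * s) = e ^ Suc j * (d * m - a * d * s)"
    by (simp add: algebra_simps)
  finally show ?case by (intro exI[of _ y']) simp
qed simp

text \<open>\<open>P(y) - P(z)\<close> is \<open>y - z\<close> times \<open>u1 + e * s\<close>,
  which is invertible modulo \<open>e\<close> and therefore modulo \<open>c\<close>, where
  \<open>e\<close> is nilpotent.\<close>

lemma hensel_injective:
  fixes a c e m u0 u1 y z :: "'a::comm_ring_1"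
  assumes au: "a * u1 + m * e = 1" and P: "P = [:u0, u1:] + smult e N"
    and c: "c dvd e ^ k" "c dvd poly P y - poly P z"
  shows "c dvd y - z"
proof -
  obtain s where s: "poly N y - poly N z = (y - z) * s" using poly_diff_dvd[of y z N] unfolding dvd_def by blast
  \<comment> \<open>Thus \<open>a * (u1 + e * s) = 1 - f\<close>, and \<open>f\<close> is nilpotent
    modulo \<open>c\<close>; the geometric sum inverts \<open>1 - f\<close>.\<close>
  define f where "f = e * (m - a * s)"
  have "poly P y - poly P z = u1 * (y - z) + e * (poly N y - poly N z)"
    unfolding P by (simp add: algebra_simps)
  then have "a * (poly P y - poly P z) = a * (u1 * (y - z) + e * ((y - z) * s))"
    by (simp only: s)
  also have "\<dots> = (a * u1 + e * a * s) * (y - z)" by (simp add: algebra_simps)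
  also have "a * u1 + e * a * s = 1 - f" using au unfolding f_def by (simp add: algebra_simps)
  finally have "c dvd (1 - f) * (y - z)" using c(2) by (metis dvd_mult)
  then have "c dvd (1 - f) * (y - z) * (\<Sum>i<k. f ^ i)" by (rule dvd_mult2)
  then have "c dvd (1 - f) * (\<Sum>i<k. f ^ i) * (y - z)" by (simp only: ac_simps)
  then have "c dvd (1 - f ^ k) * (y - z)" by (simp add: one_diff_power_eq)
  moreover have "c dvd f ^ k * (y - z)"
    using c(1) by (auto simp: f_def power_mult_distrib intro: dvd_mult2)
  ultimately have "c dvd (1 - f ^ k) * (y - z) + f ^ k * (y - z)" by (rule dvd_add)
  then show ?thesis by (simp add: algebra_simps)
qed

section \<open>Polynomials over \<open>k\<close> and their roots in an algebraically closed
  field\<close>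

lemma ideal_generator:
  fixes J :: "'k::field poly set"
  assumes J: "is_ideal J" "f \<in> J" "f \<noteq> 0"
  shows "\<exists>e\<in>J. e \<noteq> 0 \<and> (\<forall>g\<in>J. e dvd g)"
proof -
  obtain e where e: "e \<in> J \<and> e \<noteq> 0"
    and min: "\<And>g. g \<in> J \<and> g \<noteq> 0 \<Longrightarrow> degree e \<le> degree g"
    using ex_has_least_nat[of "\<lambda>g. g \<in> J \<and> g \<noteq> 0" f degree] J by blast
  have "e dvd g" if "g \<in> J" for g
  proof -
    have "g mod e = g - (g div e) * e" by (simp add: minus_div_mult_eq_mod)
    then have "g mod e \<in> J" using ideal_diff[OF J(1) that ideal_mult[OF J(1)]] e by simp
    then have "g mod e = 0"
      using min[of "g mod e"] degree_mod_less[of e g] e by fastforce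
    then show ?thesis by (simp add: dvd_eq_mod_eq_0)
  qed
  then show ?thesis using e by blast
qed

lemma rhom_field_inj:
  assumes "rhom (h :: 'a::field \<Rightarrow> 'b::{comm_ring_1,zero_neq_one})"
  shows "inj h"
proof (rule injI, rule ccontr)
  fix x y assume "h x = h y" "x \<noteq> y"
  then have "h ((x - y) * inverse (x - y)) = 0" by (simp only: rhom_simps[OF assms]) simp
  then show False using \<open>x \<noteq> y\<close> by (simp add: rhom_1[OF assms])
qed

definition root_value :: "('k::field \<Rightarrow> 'o::field) \<Rightarrow> 'o \<Rightarrow> 'k poly \<Rightarrow> 'o" where
  "root_value h \<alpha> g = poly (map_poly h g) \<alpha>"

lemma rhom_root_value: "rhom h \<Longrightarrow> rhom (root_value h \<alpha>)"
  unfolding root_value_def[abs_def] by (rule rhom_map_poly_eval)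

lemma root_value_dvd:
  assumes "rhom h" "f dvd g" "root_value h \<alpha> f = 0"
  shows "root_value h \<alpha> g = 0"
  using assms by (auto elim!: dvdE simp: rhom_mult[OF rhom_root_value])

lemma root_exists:
  fixes h :: "'k::field \<Rightarrow> 'o::alg_closed_field"
  assumes "rhom h" "degree g > 0"
  shows "\<exists>\<alpha>. root_value h \<alpha> g = 0"
  unfolding root_value_def using assms
  by (intro alg_closed_imp_poly_has_root) (simp add: degree_map_poly_inj rhom_field_inj)

lemma minimal_polynomial:
  fixes h :: "'k::field \<Rightarrow> 'o::field"
  assumes "rhom h" "c \<noteq> 0" "root_value h \<alpha> c = 0"
  shows "\<exists>p. p \<noteq> 0 \<and> (\<forall>g. root_value h \<alpha> g = 0 \<longleftrightarrow> p dvd g)"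
proof -
  have "is_ideal {g. root_value h \<alpha> g = 0}"
    by (auto simp: is_ideal_def rhom_simps[OF rhom_root_value[OF assms(1)]])
  from ideal_generator[OF this, of c] assms(2,3) root_value_dvd[OF assms(1)] show ?thesis by blast
qed

text \<open>The generator of the ideal of \<open>u\<close> and \<open>e\<close> divides both, so a
  root of it would be a common root; it is therefore a nonzero constant.\<close>

lemma bezout_no_common_root:
  fixes h :: "'k::field \<Rightarrow> 'o::alg_closed_field"
  assumes h: "rhom h" and "e \<noteq> 0"
    and no: "\<And>\<alpha>. root_value h \<alpha> e = 0 \<Longrightarrow> root_value h \<alpha> u \<noteq> 0"
  shows "\<exists>a m. a * u + m * e = 1"
proof -
  let ?J = "{a * u + m * e |a m. True}"
  have "is_ideal ?J" unfolding is_ideal_def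
  proof (intro conjI ballI allI)
    show "0 \<in> ?J" by (intro CollectI exI[of _ 0]) simp
    fix x assume "x \<in> ?J"
    then obtain a m where x: "x = a * u + m * e" by blast
    show "r * x \<in> ?J" for r
      unfolding x by (intro CollectI exI[of _ "r * a"] exI[of _ "r * m"]) (simp add: algebra_simps)
    fix y assume "y \<in> ?J"
    then obtain a' m' where y: "y = a' * u + m' * e" by blast
    show "x + y \<in> ?J"
      unfolding x y by (intro CollectI exI[of _ "a + a'"] exI[of _ "m + m'"]) (simp add: algebra_simps)
  qed
  moreover have eu: "e \<in> ?J" "u \<in> ?J"
    by (intro CollectI exI[of _ 0] exI[of _ 1], simp) (intro CollectI exI[of _ 1] exI[of _ 0], simp)
  ultimately obtain d where d: "d \<in> ?J" "d \<noteq> 0" "\<And>g. g \<in> ?J \<Longrightarrow> d dvd g"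
    using ideal_generator[of ?J e] assms(2) by blast
  have "degree d = 0"
  proof (rule ccontr)
    assume "degree d \<noteq> 0"
    then obtain \<alpha> where "root_value h \<alpha> d = 0" using root_exists[OF h, of d] by auto
    then show False using root_value_dvd[OF h d(3)] eu no by blast
  qed
  then obtain k where k: "d = [:k:]" "k \<noteq> 0" using d(2) by (auto elim!: degree_eq_zeroE)
  obtain a m where am: "d = a * u + m * e" using d(1) by blast
  have "smult (inverse k) a * u + smult (inverse k) m * e = smult (inverse k) d"
    unfolding am by (simp add: smult_add_right)
  also have "\<dots> = 1" using k by (simp add: one_pCons)
  finally show ?thesis by blast
qed

text \<open>A Nullstellensatz in one variable. The minimal polynomial of a root of \<open>c\<close>
  divides \<open>e\<close>; splitting it off from \<open>c\<close> costs one further power of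
  \<open>e\<close>.\<close>

lemma dvd_power_of_roots:
  fixes h :: "'k::field \<Rightarrow> 'o::alg_closed_field"
  assumes h: "rhom h" and "c \<noteq> 0"
    and roots: "\<And>\<alpha>. root_value h \<alpha> c = 0 \<Longrightarrow> root_value h \<alpha> e = 0"
  shows "\<exists>m. c dvd e ^ m"
  using assms(2-)
proof (induction "degree c" arbitrary: c rule: less_induct)
  case less
  show ?case
  proof (cases "degree c = 0")
    case True
    then have "c dvd 1" using less.prems(1) is_unit_iff_degree by blast
    then show ?thesis by (intro exI[of _ 0]) simp
  next
    case False
    then obtain \<alpha> where \<alpha>: "root_value h \<alpha> c = 0" using root_exists[OF h, of c] by auto
    then obtain p where p: "p \<noteq> 0" "\<And>g. root_value h \<alpha> g = 0 \<longleftrightarrow> p dvd g"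
      using minimal_polynomial[OF h less.prems(1)] by blast
    then obtain c' where c': "c = p * c'" using \<alpha> by (auto elim: dvdE)
    have "degree p \<noteq> 0"
    proof
      assume "degree p = 0"
      then have "p dvd 1" using p(1) is_unit_iff_degree by blast
      then show False using p(2)[of 1] by (simp add: rhom_1[OF rhom_root_value[OF h]])
    qed
    then have "degree c' < degree c" "c' \<noteq> 0"
      using less.prems(1) c' p(1) by (auto simp: degree_mult_eq)
    moreover have "root_value h \<beta> e = 0" if "root_value h \<beta> c' = 0" for \<beta>
      using less.prems(2) root_value_dvd[OF h _ that, of c] c' by simp
    ultimately obtain m where "c' dvd e ^ m" using less.hyps by blast
    moreover have "p dvd e" using p(2) less.prems(2) \<alpha> by blast
    ultimately have "c dvd e ^ Suc m" unfolding c' by (simp add: mult_dvd_mono)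
    then show ?thesis by blast
  qed
qed

text \<open>\<open>e\<close> generates the ideal of all polynomials that vanish at the roots of
  \<open>c\<close>.\<close>

lemma radical:
  fixes h :: "'k::field \<Rightarrow> 'o::alg_closed_field"
  assumes h: "rhom h" and "c \<noteq> 0"
  shows "\<exists>e m. e \<noteq> 0 \<and> e dvd c \<and> c dvd e ^ m \<and>
    (\<forall>g. (\<forall>\<alpha>. root_value h \<alpha> c = 0 \<longrightarrow> root_value h \<alpha> g = 0) \<longrightarrow> e dvd g)"
proof -
  let ?J = "{g. \<forall>\<alpha>. root_value h \<alpha> c = 0 \<longrightarrow> root_value h \<alpha> g = 0}"
  have "is_ideal ?J" by (auto simp: is_ideal_def rhom_simps[OF rhom_root_value[OF h]])
  then obtain e where e: "e \<in> ?J" "e \<noteq> 0" "\<And>g. g \<in> ?J \<Longrightarrow> e dvd g"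
    using ideal_generator[of ?J c] assms(2) by blast
  then obtain m where "c dvd e ^ m" using dvd_power_of_roots[OF h assms(2), of e] by blast
  moreover have "e dvd c" by (rule e(3)) simp
  ultimately show ?thesis using e by blast
qed

lemma inner_poly_eval: "[:[:a:]:] = poly (map_poly const3 a) x1"
proof (induction a)
  case (pCons b a)
  have "[:[:pCons b a:]:] = const3 b + x1 * [:[:a:]:]" by (simp add: const3_def)
  then show ?case
    unfolding pCons.IH by (simp only: map_poly_pCons rhom_0[OF rhom_const3] poly_pCons)
qed simp

text \<open>Modulo the radical \<open>e\<close> of \<open>c\<close>, \<open>U\<close> is linear in
  \<open>x2\<close> with invertible slope, so Hensel's argument expresses \<open>x2\<close> modulo
  \<open>c\<close> as a polynomial \<open>\<tau>\<close> in \<open>F\<close> over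
  \<open>k[x1]\<close>. The third coordinate is \<open>T = (x2 - \<tau>(F)) / c\<close>.\<close>

lemma linear_fibres_coordinate:
  fixes h :: "'k::field \<Rightarrow> 'o::alg_closed_field" and U :: "'k poly poly"
  assumes h: "rhom h" and c0: "c \<noteq> 0"
    and u1: "\<And>\<alpha>. root_value h \<alpha> c = 0 \<Longrightarrow> root_value h \<alpha> (coeff U 1) \<noteq> 0"
    and ui: "\<And>\<alpha> i. root_value h \<alpha> c = 0 \<Longrightarrow> 2 \<le> i \<Longrightarrow> root_value h \<alpha> (coeff U i) = 0"
  shows "\<exists>T. adjoin scalars {x1, [:U, [:c:]:], T} = UNIV"
proof -
  define F where "F = [:U, [:c:]:]"
  define \<kappa> where "\<kappa> a = [:[:a:]:]" for a :: "'k poly"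
  have \<kappa>: "rhom \<kappa>" unfolding \<kappa>_def by (intro rhomI) (auto simp: one_pCons)
  obtain e m where e: "e \<noteq> 0" "e dvd c" "c dvd e ^ m"
    and rad: "\<And>g. (\<And>\<alpha>. root_value h \<alpha> c = 0 \<Longrightarrow> root_value h \<alpha> g = 0) \<Longrightarrow> e dvd g"
    using radical[OF h c0] by blast
  obtain v0 v1 W where U: "U = pCons v0 (pCons v1 W)" by (metis pCons_cases)
  have v1: "coeff U 1 = v1" using U by simp
  have "e dvd coeff W i" for i
    using rad[of "coeff U (i + 2)"] ui[of _ "i + 2"] U by simp
  then have "[:e:] dvd W" by (simp add: const_poly_dvd_iff)
  then obtain W' where W': "W = smult e W'" by (auto elim!: dvdE)
  define N where "N = pCons 0 (pCons 0 W')"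
  have UN: "U = [:v0, v1:] + smult e N" by (simp add: U W' N_def)
  obtain a m' where au: "a * v1 + m' * e = 1"
    using bezout_no_common_root[OF h e(1), of v1] u1 root_value_dvd[OF h e(2)] unfolding v1 by blast
  \<comment> \<open>The Bezout relation and the shape of \<open>U\<close> are used twice: in
    \<open>'k poly poly\<close> to find \<open>\<tau>\<close>, and in \<open>B\<close> to compare
    \<open>x2\<close> with \<open>\<tau>(F)\<close>.\<close>
  have hom_au: "g a * g v1 + g m' * g e = 1" if "rhom g" for g :: "'k poly \<Rightarrow> 'z::comm_ring_1"
    using arg_cong[OF au, of g] by (simp add: rhom_simps[OF that])
  have hom_U: "map_poly g U = [:g v0, g v1:] + smult (g e) (map_poly g N)"
    if g: "rhom g" for g :: "'k poly \<Rightarrow> 'z::comm_ring_1"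
    unfolding UN by (simp add: rhom_add[OF rhom_map_poly[OF g]] map_poly_pCons map_poly_smult
        rhom_simps[OF g])
  obtain \<tau> where "[:e:] ^ m dvd poly (map_poly (\<lambda>a. [:a:]) U) \<tau> - [:0, 1:]"
    using hensel_surjective[OF hom_au[OF rhom_const] hom_U[OF rhom_const]] by blast
  then have "[:e ^ m:] dvd pcompose U \<tau> - [:0, 1:]"
    by (simp add: pcompose_altdef poly_const_pow)
  moreover have "[:c:] dvd [:e ^ m:]" using e(3) by (auto simp: const_poly_dvd_iff coeff_pCons split: nat.splits)
  ultimately obtain g where g: "pcompose U \<tau> - [:0, 1:] = [:c:] * g"
    using dvd_trans by (metis dvdE)
  define ev where "ev p = poly (map_poly \<kappa> p) F" for p
  have ev: "rhom ev" unfolding ev_def[abs_def] by (rule rhom_map_poly_eval[OF \<kappa>])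
  have ev_const: "ev [:a:] = \<kappa> a" and ev_X: "ev [:0, 1:] = F" for a
    by (simp_all add: ev_def map_poly_pCons rhom_simps[OF \<kappa>])
  let ?P = "map_poly \<kappa> U"
  have P\<tau>: "poly ?P (ev \<tau>) = F + \<kappa> c * ev g"
  proof -
    have "poly ?P (ev \<tau>) = ev (pcompose U \<tau>)"
      unfolding pcompose_altdef by (subst rhom_of_poly[OF ev rhom_const]) (simp add: ev_const)
    also have "pcompose U \<tau> = [:0, 1:] + [:c:] * g" using g by (simp add: algebra_simps)
    finally show ?thesis
      unfolding rhom_add[OF ev] rhom_mult[OF ev] by (simp only: ev_const ev_X)
  qed
  have Px2: "poly ?P x2 = [:U:]"
    by (induction U) (simp_all add: map_poly_pCons rhom_0[OF \<kappa>], simp add: \<kappa>_def)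
  have F: "F = \<kappa> c * x3 + poly ?P x2" unfolding Px2 by (simp add: F_def \<kappa>_def)
  \<comment> \<open>Both values are congruent to \<open>F\<close> modulo \<open>c\<close>.\<close>
  have "\<kappa> c dvd poly ?P x2 - poly ?P (ev \<tau>)"
  proof -
    have "p - (k * x + p + k * g) = k * (- x - g)" for p k x g :: "'k poly poly poly"
      by (simp add: algebra_simps)
    then show ?thesis unfolding P\<tau> F by (metis dvd_triv_left)
  qed
  moreover have "\<kappa> c dvd \<kappa> e ^ m"
    using e(3) by (metis dvdE dvdI rhom_mult[OF \<kappa>] rhom_power[OF \<kappa>])
  ultimately have "\<kappa> c dvd x2 - ev \<tau>" using hensel_injective[OF hom_au[OF \<kappa>] hom_U[OF \<kappa>]] by blast
  then obtain T where T: "x2 - ev \<tau> = \<kappa> c * T" by (auto elim: dvdE)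
  let ?S = "adjoin scalars {x1, F, T}"
  have S: "is_subring ?S" by (rule adjoin_subring)
  have gens: "x1 \<in> ?S" "F \<in> ?S" "T \<in> ?S" by (auto intro: adjoin_gen)
  have \<kappa>S: "\<kappa> a \<in> ?S" for a
  proof -
    have "\<kappa> a = poly (map_poly const3 a) x1"
      unfolding \<kappa>_def by (rule inner_poly_eval)
    moreover have "const3 b \<in> ?S" for b by (intro adjoin_base) (simp add: scalars_const3)
    ultimately show ?thesis
      using gens(1) by (auto intro!: subring_poly[OF S] simp: coeff_map_poly rhom_0[OF rhom_const3])
  qed
  have evS: "ev p \<in> ?S" for p unfolding ev_def
    by (rule subring_poly[OF S _ gens(2)]) (simp add: coeff_map_poly rhom_0[OF \<kappa>] \<kappa>S)
  have x2S: "x2 \<in> ?S"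
  proof -
    have "x2 = ev \<tau> + \<kappa> c * T" using T by (simp add: algebra_simps)
    then show ?thesis using evS \<kappa>S gens by (metis subring_add[OF S] subring_mult[OF S])
  qed
  \<comment> \<open>To recover \<open>x3\<close>, the equation \<open>c * x3 = F - U(x2)\<close> is
    divided by \<open>c\<close> within \<open>?S\<close>: the difference
    \<open>U(x2) - U(\<tau>(F))\<close> is \<open>c * T\<close> times an element of
    \<open>?S\<close>.\<close>
  obtain s where s: "s \<in> ?S" "poly ?P x2 - poly ?P (ev \<tau>) = (x2 - ev \<tau>) * s"
    using poly_diff_factor_subring[OF S _ x2S evS] by (force simp: coeff_map_poly rhom_0[OF \<kappa>] \<kappa>S)
  have "\<kappa> c * x3 = F - poly ?P x2" using F by simp
  also have "\<dots> = \<kappa> c * (- ev g - T * s)" using s(2) unfolding P\<tau> T by (simp add: algebra_simps)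
  finally have "x3 = - ev g - T * s" using c0 by (subst (asm) mult_cancel_left) (simp add: \<kappa>_def)
  then have "x3 \<in> ?S" using evS gens s(1)
    by (simp only:) (intro subring_diff[OF S] subring_uminus[OF S] subring_mult[OF S])
  then have "adjoin scalars {x1, x2, x3} \<subseteq> ?S"
    using gens x2S by (intro adjoin_least[OF S]) (auto intro: adjoin_base)
  then show ?thesis unfolding adjoin_standard F_def by blast
qed

section \<open>Extension of scalars to the algebraic closure of \<open>k(X)\<close>\<close>

text \<open>For \<open>H \<noteq> 0\<close> the product \<open>p(y) * H\<close> would have degree at
  least \<open>degree p * degree y\<close>, but it equals a constant minus \<open>r(y)\<close>, of
  degree at most \<open>degree r * degree y\<close>.\<close>

lemma local_divisor_vanishes:
  fixes g :: "'k::field \<Rightarrow> 'a::idom" and y H :: "'a poly"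
  assumes g: "rhom g" and y: "degree y > 0" and r: "degree r < degree p"
    and eq: "[:x:] = poly (map_poly (\<lambda>c. [:g c:]) r) y + poly (map_poly (\<lambda>c. [:g c:]) p) y * H"
  shows "H = 0"
proof (rule ccontr)
  assume H: "H \<noteq> 0"
  have deg: "degree (poly (map_poly (\<lambda>c. [:g c:]) s) y) = degree s * degree y" for s
  proof -
    have "poly (map_poly (\<lambda>c. [:g c:]) s) y = pcompose (map_poly g s) y"
      by (simp add: pcompose_altdef map_poly_rhom_comp[OF rhom_const g])
    then show ?thesis
      by (simp add: degree_pcompose degree_map_poly_inj[OF g rhom_field_inj[OF g]])
  qed
  let ?p = "poly (map_poly (\<lambda>c. [:g c:]) p) y" and ?r = "poly (map_poly (\<lambda>c. [:g c:]) r) y"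
  have "degree ?p > 0" using deg[of p] y r by simp
  then have "?p \<noteq> 0" by auto
  then have "degree (?p * H) = degree p * degree y + degree H" using H deg by (simp add: degree_mult_eq)
  moreover have "?p * H = [:x:] - ?r" using eq by (simp add: algebra_simps)
  moreover have "degree ([:x:] - ?r) \<le> degree r * degree y"
    using deg[of r] by (intro degree_diff_le) auto
  ultimately have "degree p * degree y \<le> degree r * degree y" by (metis add_leD1)
  then show False using r y by simp
qed

lemma middle_poly_eval: "[:V :: 'k::field poly poly:] = poly (map_poly (\<lambda>a. [:[:a:]:]) V) x2"
proof (induction V)
  case (pCons a V)
  have r: "rhom (\<lambda>a. [:[:a:]:])" by (rule rhom_comp[OF rhom_const rhom_const])
  have "[:pCons a V:] = [:[:a:]:] + x2 * [:V:]" by simp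
  then show ?case unfolding pCons.IH by (simp only: map_poly_pCons rhom_0[OF r] poly_pCons)
qed simp

text \<open>The triangular coordinates are moved to the standard variables
  \<open>x1, x2, x3\<close>. The variable of the domain of \<open>\<rho>\<close> stands for the
  coordinate \<open>X\<close>, so \<open>\<rho>\<close> embeds \<open>k[X]\<close> into
  \<open>\<Omega>\<close>, the type \<open>'o\<close>; on constants it embeds
  \<open>k\<close>.\<close>

locale invariant_coordinate =
  fixes \<delta> :: "'k::field poly poly poly \<Rightarrow> 'k poly poly poly poly"
    and c :: "'k poly" and U :: "'k poly poly" and X Y Z :: "'k poly poly poly"
    and \<rho> :: "'k poly \<Rightarrow> 'o::{alg_closed_field, field_gcd}"
  assumes rhom: "rhom \<delta>"
    and at_0: "poly (\<delta> x) 0 = x"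
    and scal: "\<delta> (const3 a) = [:const3 a:]"
    and x1_inv: "\<delta> x1 = [:x1:]"
    and x2_not_inv: "degree (\<delta> x2) > 0"
    and F_inv: "\<delta> [:U, [:c:]:] = [:[:U, [:c:]:]:]"
    and c0: "c \<noteq> 0"
    and coord: "adjoin scalars {X, Y, Z} = UNIV"
    and X_inv: "\<delta> X = [:X:]"
    and X_new: "X \<notin> range (\<lambda>a. [:[:a:]:])"
    and \<rho>: "rhom \<rho>" "inj \<rho>"
    and nonconstant: "\<And>\<alpha>. root_value (\<lambda>a. \<rho> [:a:]) \<alpha> c = 0 \<Longrightarrow>
      \<exists>i\<ge>1. root_value (\<lambda>a. \<rho> [:a:]) \<alpha> (coeff U i) \<noteq> 0"
begin

section \<open>The ring of invariants in standard coordinates\<close>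

definition "F = [:U, [:c:]:]"

definition "\<kappa> = (\<lambda>a :: 'k poly. [:[:a:]:])"

lemma rhom_\<kappa>: "rhom \<kappa>"
  unfolding \<kappa>_def by (intro rhomI) (auto simp: one_pCons)

abbreviation "val \<equiv> root_value (\<lambda>a. \<rho> [:a:])"

lemma rhom_\<rho>0: "rhom (\<lambda>a. \<rho> [:a:])"
  by (rule rhom_comp[OF \<rho>(1) rhom_const])

lemma rhom_value: "rhom (val \<alpha>)"
  by (rule rhom_root_value[OF rhom_\<rho>0])

text \<open>The substitution \<open>h \<mapsto> h(x1, F)\<close>; its range is the ring
  \<open>k[x1, F]\<close>.\<close>

definition "in_F = (\<lambda>h. poly (map_poly \<kappa> h) F)"

lemma rhom_in_F: "rhom in_F"
  unfolding in_F_def by (rule rhom_map_poly_eval[OF rhom_\<kappa>])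

lemma in_F_const: "in_F [:a:] = \<kappa> a" and in_F_X: "in_F [:0, 1:] = F"
  by (simp_all add: in_F_def map_poly_pCons rhom_simps[OF rhom_\<kappa>])

lemma subring_in_F: "is_subring (range in_F)"
  by (rule subring_range[OF rhom_in_F])

lemma \<kappa>_in_F: "\<kappa> a \<in> range in_F" and F_in_F: "F \<in> range in_F"
  by (metis in_F_const rangeI, metis in_F_X rangeI)

lemma degree_in_F: "degree (in_F h) = degree h"
proof -
  have "in_F h = pcompose (map_poly (\<lambda>a. [:a:]) h) F"
    unfolding in_F_def \<kappa>_def pcompose_altdef map_poly_rhom_comp[OF rhom_const rhom_const] ..
  moreover have "degree F = 1" using c0 by (simp add: F_def)
  ultimately show ?thesis
    by (simp add: degree_pcompose degree_map_poly_inj[OF rhom_const] inj_def)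
qed

lemma \<kappa>_eval: "\<kappa> a = poly (map_poly const3 a) x1"
  unfolding \<kappa>_def by (rule inner_poly_eval)

lemma \<delta>_\<kappa>: "\<delta> (\<kappa> a) = [:\<kappa> a:]"
  unfolding \<kappa>_eval
  by (simp add: rhom_of_poly[OF rhom rhom_const3] rhom_of_poly[OF rhom_const rhom_const3] scal x1_inv)

lemma \<delta>_in_F: "\<delta> (in_F h) = [:in_F h:]"
  unfolding in_F_def
  using F_inv by (simp add: rhom_of_poly[OF rhom rhom_\<kappa>] rhom_of_poly[OF rhom_const rhom_\<kappa>] \<delta>_\<kappa> F_def)

lemma F_split: "F = \<kappa> c * x3 + poly (map_poly \<kappa> U) x2"
proof -
  have "[:[:c:]:] * x3 + [:U:] = F" by (simp add: F_def)
  then show ?thesis unfolding \<kappa>_def middle_poly_eval[of U] by simp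
qed

text \<open>Once \<open>c\<close> is inverted, \<open>x3\<close> becomes
  \<open>(F - U(x1, x2)) / c\<close>, so that every element is a polynomial in \<open>x2\<close>
  over \<open>k[x1, F]\<close> up to a power of \<open>c\<close>.\<close>

lemma localized_polynomial_in_x2:
  "\<exists>N E. (\<forall>i. coeff E i \<in> range in_F) \<and> \<kappa> c ^ N * b = poly E x2"
proof -
  note Sp = subring_poly_coeffs[OF subring_in_F]
  define S where "S = {b. \<exists>N E. E \<in> {p. \<forall>i. coeff p i \<in> range in_F} \<and> \<kappa> c ^ N * b = poly E x2}"
  have const: "[:a:] \<in> {p. \<forall>i. coeff p i \<in> range in_F}" if "a \<in> range in_F" for a
    using that subring_0[OF subring_in_F] by (auto simp: coeff_pCons split: nat.splits)
  have cN: "[:\<kappa> c ^ n:] \<in> {p. \<forall>i. coeff p i \<in> range in_F}" for n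
    by (intro const subring_power[OF subring_in_F] \<kappa>_in_F)
  have S: "is_subring S" unfolding is_subring_def
  proof (intro conjI ballI)
    show "1 \<in> S" unfolding S_def
      by (intro CollectI exI[of _ 0] exI[of _ 1] conjI subring_1[OF Sp]) simp
    fix a b assume "a \<in> S" "b \<in> S"
    then obtain N E M G where E: "E \<in> {p. \<forall>i. coeff p i \<in> range in_F}" "\<kappa> c ^ N * a = poly E x2"
      and G: "G \<in> {p. \<forall>i. coeff p i \<in> range in_F}" "\<kappa> c ^ M * b = poly G x2"
      unfolding S_def by blast
    have "\<kappa> c ^ (N + M) * (a - b) = \<kappa> c ^ M * (\<kappa> c ^ N * a) - \<kappa> c ^ N * (\<kappa> c ^ M * b)"
      by (simp only: power_add algebra_simps)
    also have "\<dots> = poly ([:\<kappa> c ^ M:] * E - [:\<kappa> c ^ N:] * G) x2"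
      unfolding E(2) G(2) by (simp only: poly_diff poly_mult poly_pCons poly_0 mult_zero_right add_0_right)
    finally show "a - b \<in> S" unfolding S_def
      using subring_diff[OF Sp subring_mult[OF Sp cN E(1)] subring_mult[OF Sp cN G(1)]] by blast
    have "\<kappa> c ^ (N + M) * (a * b) = (\<kappa> c ^ N * a) * (\<kappa> c ^ M * b)"
      by (simp only: power_add ac_simps)
    also have "\<dots> = poly (E * G) x2" unfolding E(2) G(2) by (simp only: poly_mult)
    finally show "a * b \<in> S" unfolding S_def using subring_mult[OF Sp E(1) G(1)] by blast
  qed
  have embed: "a \<in> S" if "a \<in> range in_F" for a
    unfolding S_def using const[OF that] by (intro CollectI exI[of _ 0] exI[of _ "[:a:]"]) simp
  have "x1 = \<kappa> [:0, 1:]" "const3 a = \<kappa> [:a:]" for a by (simp_all add: \<kappa>_def const3_def)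
  then have "x1 \<in> S" "const3 a \<in> S" for a using embed \<kappa>_in_F by metis+
  moreover have "x2 \<in> S" unfolding S_def
    using subring_0[OF subring_in_F] subring_1[OF subring_in_F]
    by (intro CollectI exI[of _ 0] exI[of _ "[:0, 1:]"]) (auto simp: coeff_pCons split: nat.splits)
  moreover have "x3 \<in> S"
  proof -
    have "\<kappa> c ^ 1 * x3 = F - poly (map_poly \<kappa> U) x2" using F_split by simp
    also have "\<dots> = poly ([:F:] - map_poly \<kappa> U) x2"
      by (simp only: poly_diff poly_pCons poly_0 mult_zero_right add_0_right)
    finally have "\<kappa> c ^ 1 * x3 = poly ([:F:] - map_poly \<kappa> U) x2" .
    moreover have "map_poly \<kappa> U \<in> {p. \<forall>i. coeff p i \<in> range in_F}"
      by (auto simp: coeff_map_poly rhom_0[OF rhom_\<kappa>] \<kappa>_in_F)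
    ultimately show ?thesis unfolding S_def using subring_diff[OF Sp const[OF F_in_F]] by blast
  qed
  ultimately have "adjoin scalars {x1, x2, x3} \<subseteq> S"
    by (intro adjoin_least[OF S]) (auto simp: scalars_const3)
  then show ?thesis using adjoin_standard unfolding S_def by blast
qed

text \<open>A polynomial \<open>E\<close> in \<open>x2\<close> with invariant coefficients is mapped
  to \<open>E(\<delta>(x2))\<close>, of \<open>t\<close>-degree \<open>degree E\<close> times that
  of \<open>\<delta>(x2)\<close>; invariance leaves only constant \<open>E\<close>.\<close>

lemma invariant_localized:
  assumes "\<delta> b = [:b:]"
  shows "\<exists>N. \<kappa> c ^ N * b \<in> range in_F"
proof -
  obtain N E where E: "\<And>i. coeff E i \<in> range in_F" "\<kappa> c ^ N * b = poly E x2"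
    using localized_polynomial_in_x2 by blast
  have "map_poly \<delta> E = map_poly (\<lambda>a. [:a:]) E"
    using E(1) \<delta>_in_F by (intro poly_eqI) (auto simp: coeff_map_poly rhom_0[OF rhom] elim!: rangeE, metis rangeE)
  then have "\<delta> (poly E x2) = pcompose E (\<delta> x2)"
    by (simp only: rhom_poly_eq[OF rhom] pcompose_altdef)
  moreover have "\<delta> (\<kappa> c ^ N * b) = [:\<kappa> c ^ N * b:]"
    by (simp add: rhom_simps[OF rhom] \<delta>_\<kappa> assms poly_const_pow)
  ultimately have "degree (pcompose E (\<delta> x2)) = 0" using E(2) by simp
  then have "degree E = 0" using x2_not_inv by (simp add: degree_pcompose)
  then obtain a where "E = [:a:]" by (auto elim!: degree_eq_zeroE)
  then show ?thesis using E by (metis coeff_pCons_0 mult_zero_right poly_pCons poly_0 add_0_right)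
qed

text \<open>Setting \<open>x1 = \<alpha>\<close>, a homomorphism from \<open>B\<close> to
  \<open>\<Omega>[x2, x3]\<close>.\<close>

definition "reduce \<alpha> = map_poly (map_poly (val \<alpha>))"

lemma rhom_reduce: "rhom (reduce \<alpha>)"
  unfolding reduce_def by (intro rhom_map_poly rhom_value)

lemma reduce_\<kappa>: "reduce \<alpha> (\<kappa> a) = [:[:val \<alpha> a:]:]"
  by (simp add: reduce_def \<kappa>_def map_poly_pCons rhom_0[OF rhom_value])

lemma reduce_F: "val \<alpha> c = 0 \<Longrightarrow> reduce \<alpha> F = [:map_poly (val \<alpha>) U:]"
  by (simp add: reduce_def F_def map_poly_pCons rhom_0[OF rhom_value])

lemma reduce_in_F:
  assumes "val \<alpha> c = 0"
  shows "reduce \<alpha> (in_F h) = [:pcompose (map_poly (val \<alpha>) h) (map_poly (val \<alpha>) U):]"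
proof -
  have "reduce \<alpha> (in_F h) = poly (map_poly (\<lambda>a. [:[:val \<alpha> a:]:]) h) [:map_poly (val \<alpha>) U:]"
    unfolding in_F_def
    by (simp add: rhom_of_poly[OF rhom_reduce rhom_\<kappa>] reduce_\<kappa> reduce_F[OF assms])
  also have "\<dots> = [:poly (map_poly (\<lambda>a. [:val \<alpha> a:]) h) (map_poly (val \<alpha>) U):]"
    by (subst rhom_of_poly[OF rhom_const rhom_comp[OF rhom_const rhom_value], symmetric]) simp
  finally show ?thesis
    by (simp add: pcompose_altdef map_poly_rhom_comp[OF rhom_const rhom_value])
qed

lemma degree_fibre: "val \<alpha> c = 0 \<Longrightarrow> degree (map_poly (val \<alpha>) U) > 0"
proof -
  assume "val \<alpha> c = 0"
  then obtain i where "i \<ge> 1" "coeff (map_poly (val \<alpha>) U) i \<noteq> 0"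
    using nonconstant by (auto simp: coeff_map_poly rhom_0[OF rhom_value])
  then show ?thesis using le_degree[of "map_poly (val \<alpha>) U" i] by linarith
qed

text \<open>Let \<open>p\<close> be the minimal polynomial of a root \<open>\<alpha>\<close> of
  \<open>c'\<close>. Setting \<open>x1 = \<alpha>\<close> gives
  \<open>h(\<alpha>, U(\<alpha>, x2)) = 0\<close>. Since \<open>U(\<alpha>, x2)\<close> is not
  constant, all coefficients of \<open>h\<close> vanish at \<open>\<alpha>\<close>, so
  \<open>p\<close> divides \<open>h\<close> and can be cancelled.\<close>

lemma cancel_in_F:
  assumes "c' \<noteq> 0" "\<And>\<alpha>. val \<alpha> c' = 0 \<Longrightarrow> val \<alpha> c = 0" "\<kappa> c' * b \<in> range in_F"
  shows "b \<in> range in_F"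
  using assms
proof (induction "degree c'" arbitrary: c' b rule: less_induct)
  case less
  show ?case
  proof (cases "degree c' = 0")
    case True
    then obtain a where a: "c' = [:a:]" "a \<noteq> 0" using less.prems(1) by (auto elim!: degree_eq_zeroE)
    have "\<kappa> [:inverse a:] * (\<kappa> c' * b) \<in> range in_F"
      by (intro subring_mult[OF subring_in_F] less.prems(3) \<kappa>_in_F)
    moreover have "\<kappa> [:inverse a:] * \<kappa> c' = 1" using a by (simp add: \<kappa>_def one_pCons)
    then have "\<kappa> [:inverse a:] * (\<kappa> c' * b) = b" by (simp only: mult.assoc[symmetric] mult_1)
    ultimately show ?thesis by simp
  next
    case False
    then obtain \<alpha> where \<alpha>: "val \<alpha> c' = 0" using root_exists[OF rhom_\<rho>0, of c'] by auto
    then obtain p where p: "p \<noteq> 0" "\<And>g. val \<alpha> g = 0 \<longleftrightarrow> p dvd g"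
      using minimal_polynomial[OF rhom_\<rho>0 less.prems(1)] by blast
    then obtain c'' where c'': "c' = p * c''" using \<alpha> by (auto elim: dvdE)
    have "\<not> p dvd 1" using p(2)[of 1] by (simp add: rhom_1[OF rhom_value])
    then have "degree p \<noteq> 0" using p(1) is_unit_iff_degree by blast
    then have deg: "degree c'' < degree c'" "c'' \<noteq> 0"
      using less.prems(1) c'' p(1) by (auto simp: degree_mult_eq)
    have "\<kappa> p * (\<kappa> c'' * b) \<in> range in_F"
      using less.prems(3) c'' by (simp add: rhom_mult[OF rhom_\<kappa>] mult.assoc)
    then obtain h where h: "\<kappa> p * (\<kappa> c'' * b) = in_F h" by blast
    have "reduce \<alpha> (\<kappa> p) = 0" using p(2)[of p] by (simp add: reduce_\<kappa>)
    then have "reduce \<alpha> (in_F h) = 0" using h[symmetric] by (simp add: rhom_mult[OF rhom_reduce])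
    then have "pcompose (map_poly (val \<alpha>) h) (map_poly (val \<alpha>) U) = 0"
      using reduce_in_F less.prems(2) \<alpha> by simp
    then have "map_poly (val \<alpha>) h = 0"
      using pcompose_eq_0[OF _ degree_fibre] less.prems(2) \<alpha> by blast
    then have "val \<alpha> (coeff h i) = 0" for i
      using coeff_map_poly[of "val \<alpha>" h i] by (simp add: rhom_0[OF rhom_value])
    then have "[:p:] dvd h" by (simp add: const_poly_dvd_iff p(2))
    then obtain h' where "h = [:p:] * h'" by (auto elim: dvdE)
    then have "\<kappa> p * (\<kappa> c'' * b) = \<kappa> p * in_F h'"
      using h by (simp only: rhom_mult[OF rhom_in_F] in_F_const)
    moreover have "\<kappa> p \<noteq> 0" using p(1) by (simp add: \<kappa>_def)
    ultimately have "\<kappa> c'' * b \<in> range in_F" by simp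
    moreover have "val \<beta> c = 0" if "val \<beta> c'' = 0" for \<beta>
      using less.prems(2) that c'' by (simp add: rhom_mult[OF rhom_value])
    ultimately show ?thesis using less.hyps[OF deg] by blast
  qed
qed

lemma invariants_in_F:
  assumes "\<delta> b = [:b:]"
  shows "b \<in> range in_F"
proof -
  obtain N where "\<kappa> c ^ N * b \<in> range in_F" using invariant_localized[OF assms] by blast
  then have "\<kappa> (c ^ N) * b \<in> range in_F" by (simp add: rhom_power[OF rhom_\<kappa>])
  then show ?thesis
    using c0 by (rule_tac cancel_in_F[of "c ^ N"]) (auto simp: rhom_power[OF rhom_value])
qed

section \<open>The coordinate \<open>X\<close> as a polynomial in \<open>x1\<close> and
  \<open>F\<close>\<close>

definition "P = (SOME h. in_F h = X)"

lemma X_eq: "X = in_F P"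
  using invariants_in_F[OF X_inv] unfolding P_def by (metis (mono_tags) imageE someI)

lemma degree_X: "degree X > 0"
proof (rule ccontr)
  assume "\<not> degree X > 0"
  then have "degree P = 0" using X_eq degree_in_F[of P] by simp
  then obtain a where "P = [:a:]" by (auto elim!: degree_eq_zeroE)
  then have "X = [:[:a:]:]" using X_eq in_F_const by (simp add: \<kappa>_def)
  then show False using X_new by blast
qed

text \<open>The automorphism sending \<open>x1, x2, x3\<close> to \<open>X, Y, Z\<close>; its
  inverse \<open>\<psi>\<close> writes an element of \<open>B\<close> as a polynomial in
  \<open>X, Y, Z\<close>.\<close>

definition "\<theta> = eval3 const3 X Y Z"

lemma bij_\<theta>: "bij \<theta>" and rhom_\<theta>: "rhom \<theta>"
  unfolding \<theta>_def by (rule bij_eval3[OF coord], rule rhom_eval3[OF rhom_const3])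

definition "\<psi> = inv_into UNIV \<theta>"

lemma rhom_\<psi>: "rhom \<psi>" and \<theta>_\<psi>: "\<theta> (\<psi> b) = b" and \<psi>_\<theta>: "\<psi> (\<theta> b) = b" and inj_\<psi>: "inj \<psi>"
  unfolding \<psi>_def using rhom_inv[OF rhom_\<theta> bij_\<theta>] bij_\<theta>
  by (auto simp: bij_is_surj surj_f_inv_f bij_is_inj bij_imp_bij_inv)

lemma \<theta>_simps: "\<theta> (const3 a) = const3 a" "\<theta> x1 = X" "\<theta> x2 = Y" "\<theta> x3 = Z"
  unfolding \<theta>_def by (simp_all only: eval3_simps[OF rhom_const3])

lemma \<psi>_simps: "\<psi> (const3 a) = const3 a" "\<psi> X = x1" "\<psi> Y = x2" "\<psi> Z = x3"
  using \<psi>_\<theta> \<theta>_simps by metis+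

lemma \<theta>_\<kappa>: "\<theta> (\<kappa> g) = poly (map_poly const3 g) X"
  unfolding \<kappa>_eval by (simp add: rhom_of_poly[OF rhom_\<theta> rhom_const3] \<theta>_simps)

text \<open>Otherwise \<open>x1 \<in> k[X]\<close>. As \<open>X\<close> involves \<open>x3\<close>,
  so does every nonconstant polynomial in \<open>X\<close>, whereas \<open>x1\<close> does
  not.\<close>

lemma \<psi>_x1_not_\<kappa>: "\<psi> x1 \<noteq> \<kappa> g"
proof
  assume "\<psi> x1 = \<kappa> g"
  then have x1: "x1 = poly (map_poly const3 g) X" using \<theta>_\<psi>[of x1] \<theta>_\<kappa> by simp
  have r: "rhom (\<lambda>a. [:[:a:]:])" by (rule rhom_comp[OF rhom_const rhom_const])
  have "poly (map_poly const3 g) X = pcompose (map_poly (\<lambda>a. [:[:a:]:]) g) X"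
    by (simp add: pcompose_altdef map_poly_rhom_comp[OF rhom_const r] const3_def[abs_def])
  then have "degree (poly (map_poly const3 g) X) = degree g * degree X"
    by (simp add: degree_pcompose degree_map_poly_inj[OF r rhom_field_inj[OF r]])
  moreover have "degree (poly (map_poly const3 g) X) = 0" using arg_cong[OF x1, of degree] by simp
  ultimately have "degree g = 0" using degree_X by simp
  then obtain a where "g = [:a:]" by (auto elim!: degree_eq_zeroE)
  then show False using x1 by (simp add: map_poly_pCons rhom_0[OF rhom_const3]) (simp add: const3_def)
qed

text \<open>Otherwise \<open>X \<equiv> r(x1)\<close> modulo the minimal polynomial of \<open>\<alpha>\<close> at \<open>x1\<close>, with \<open>r\<close> of smaller
  degree; this is impossible by comparing degrees in \<open>Y\<close> and \<open>Z\<close>, where \<open>X\<close> has degree 0.\<close>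

lemma P_nonconstant_on_fibre:
  assumes \<alpha>: "val \<alpha> c = 0"
  shows "\<exists>i\<ge>1. val \<alpha> (coeff P i) \<noteq> 0"
proof (rule ccontr)
  assume no: "\<not> ?thesis"
  obtain p where p: "p \<noteq> 0" "\<And>g. val \<alpha> g = 0 \<longleftrightarrow> p dvd g"
    using minimal_polynomial[OF rhom_\<rho>0 c0 \<alpha>] by blast
  have "\<not> p dvd 1" using p(2)[of 1] by (simp add: rhom_1[OF rhom_value])
  then have degp: "degree p > 0" using p(1) is_unit_iff_degree by blast
  define r where "r = coeff P 0 mod p"
  have r: "degree r < degree p"
    using degree_mod_less'[of p "coeff P 0"] degp p(1) unfolding r_def by (cases "coeff P 0 mod p = 0") auto
  \<comment> \<open>By assumption only the constant coefficient of \<open>P\<close> can be nonzero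
    at \<open>\<alpha>\<close>, and \<open>r\<close> is its remainder modulo
    \<open>p\<close>.\<close>
  have "p dvd coeff (P - [:r:]) i" for i
    using no p(2) by (cases i) (auto simp: r_def minus_mod_eq_mult_div)
  then have "[:p:] dvd P - [:r:]" by (simp add: const_poly_dvd_iff)
  then obtain h where h: "P - [:r:] = [:p:] * h" by (auto elim: dvdE)
  have "P = [:r:] + [:p:] * h" using h by (simp add: algebra_simps)
  from arg_cong[OF this, of in_F] have X: "X = \<kappa> r + \<kappa> p * in_F h"
    by (simp only: X_eq[symmetric] rhom_simps[OF rhom_in_F] in_F_const)
  define y H where "y = \<psi> x1" and "H = \<psi> (in_F h)"
  have \<psi>_\<kappa>: "\<psi> (\<kappa> g) = poly (map_poly const3 g) y" for g
    unfolding \<kappa>_eval y_def by (simp add: rhom_of_poly[OF rhom_\<psi> rhom_const3] \<psi>_simps)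
  have eq: "x1 = poly (map_poly const3 r) y + poly (map_poly const3 p) y * H"
    using arg_cong[OF X, of \<psi>] unfolding \<psi>_simps rhom_simps[OF rhom_\<psi>] \<psi>_\<kappa> H_def .
  have r2: "rhom (\<lambda>a. [:[:a:]:])" by (rule rhom_comp[OF rhom_const rhom_const])
  have "H = 0"
  \<comment> \<open>If \<open>y\<close> involves the outer variable, which stands for
    \<open>Z\<close>, degrees in it are compared. Otherwise \<open>H\<close> is free of it too, and
    the degree in the variable for \<open>Y\<close> decides, since \<open>y\<close> is not a
    polynomial in \<open>X\<close> alone.\<close>
  proof (cases "degree y > 0")
    case True
    show ?thesis
      by (rule local_divisor_vanishes[OF r2 True r]) (use eq in \<open>simp add: const3_def[abs_def]\<close>)
  next
    case False
    then obtain y1 where y1: "y = [:y1:]" by (auto elim!: degree_eq_zeroE)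
    have y1': "degree y1 > 0"
    proof (rule ccontr)
      assume "\<not> degree y1 > 0"
      then obtain g where "y = \<kappa> g" using y1 by (auto elim!: degree_eq_zeroE simp: \<kappa>_def)
      then show False using \<psi>_x1_not_\<kappa> y_def by simp
    qed
    have at_y: "poly (map_poly const3 s) y = [:poly (map_poly (\<lambda>a. [:[:a:]:]) s) y1:]" for s
      unfolding y1 by (subst rhom_of_poly[OF rhom_const r2]) (simp add: const3_def[abs_def])
    let ?p = "poly (map_poly (\<lambda>a. [:[:a:]:]) p) y1"
    have "[:?p:] * H = x1 - [:poly (map_poly (\<lambda>a. [:[:a:]:]) r) y1:]"
      using eq unfolding at_y by (metis add_diff_cancel_left')
    then have "[:?p:] * H = [:x2 - poly (map_poly (\<lambda>a. [:[:a:]:]) r) y1:]" by simp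
    then have "degree ([:?p:] * H) = 0" by (simp only: degree_pCons_0)
    moreover have "?p \<noteq> 0"
    proof -
      have "?p = pcompose (map_poly (\<lambda>a. [:a:]) p) y1"
        by (simp add: pcompose_altdef map_poly_rhom_comp[OF rhom_const rhom_const])
      then have "degree ?p = degree p * degree y1"
        by (simp add: degree_pcompose degree_map_poly_inj[OF rhom_const] inj_def)
      then show ?thesis using degp y1' by force
    qed
    ultimately have "degree H = 0" by simp
    then obtain H1 where H1: "H = [:H1:]" by (auto elim!: degree_eq_zeroE)
    have "[:[:0, 1:]:] = poly (map_poly (\<lambda>a. [:[:a:]:]) r) y1 + ?p * H1"
      using eq unfolding at_y H1 by simp
    then have "H1 = 0" by (rule local_divisor_vanishes[OF rhom_const y1' r])
    then show ?thesis using H1 by simp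
  qed
  then have "in_F h = 0" using \<theta>_\<psi>[of "in_F h"] by (simp add: H_def rhom_0[OF rhom_\<theta>])
  then have "X = [:[:r:]:]" using X by (simp add: \<kappa>_def)
  then show False using X_new by blast
qed

end

text \<open>Units have nonzero image and the target is a domain, so some prime factor of
  \<open>x\<close> is sent to 0.\<close>

lemma prime_divisor_in_kernel:
  fixes g :: "'a::factorial_semiring \<Rightarrow> 'b::idom"
  assumes "x \<noteq> 0" "g x = 0" and g: "g 1 = 1" "\<And>x y. g (x * y) = g x * g y"
  shows "\<exists>q. prime_elem q \<and> q dvd x \<and> g q = 0"
  using assms(1,2)
proof (induction x rule: prime_divisors_induct)
  case (unit x)
  then obtain y where "x * y = 1" by (metis dvdE)
  then have "g x * g y = 1" using g by metis
  then show ?case using unit by simp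
next
  case (factor p x)
  show ?case
  proof (cases "g p = 0")
    case True
    then show ?thesis using factor(1) by (intro exI[of _ p]) (auto intro: prime_imp_prime_elem)
  next
    case False
    then have "g x = 0" "x \<noteq> 0" using factor g by auto
    then obtain q where "prime_elem q" "q dvd x" "g q = 0" using factor.IH by blast
    then show ?thesis by (intro exI[of _ q]) (auto intro: dvd_mult)
  qed
qed simp

text \<open>Over an algebraically closed field \<open>p\<close> is a nonzero constant times linear
  factors; the prime divides one of these at \<open>y\<close>.\<close>

lemma prime_divides_linear_factor:
  fixes CC :: "'o::alg_closed_field \<Rightarrow> 'd::idom"
  assumes CC: "rhom CC" and q: "prime_elem q" and "p \<noteq> 0" "q dvd poly (map_poly CC p) y"
  shows "\<exists>\<gamma>. poly p \<gamma> = 0 \<and> q dvd y - CC \<gamma>"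
  using assms(3,4)
proof (induction "degree p" arbitrary: p rule: less_induct)
  case less
  show ?case
  proof (cases "degree p = 0")
    case True
    then obtain a where a: "p = [:a:]" "a \<noteq> 0" using less.prems(1) by (auto elim!: degree_eq_zeroE)
    have "q dvd CC a" using less.prems(2) a by (simp add: map_poly_pCons rhom_0[OF CC])
    then have "q dvd CC a * CC (inverse a)" by (rule dvd_mult2)
    then have "q dvd 1" using a by (simp add: rhom_mult[OF CC, symmetric] rhom_1[OF CC])
    then show ?thesis using q by (simp add: prime_elem_def)
  next
    case False
    then obtain \<gamma> where \<gamma>: "poly p \<gamma> = 0" using alg_closed_imp_poly_has_root by blast
    then obtain s where s: "p = [:- \<gamma>, 1:] * s" by (metis poly_eq_0_iff_dvd dvdE)
    have s0: "s \<noteq> 0" using s less.prems(1) by auto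
    have deg: "degree s < degree p" unfolding s using s0 by (subst degree_mult_eq) auto
    have "poly (map_poly CC p) y = (y - CC \<gamma>) * poly (map_poly CC s) y"
      unfolding s rhom_mult[OF rhom_map_poly_eval[OF CC]]
      by (simp add: map_poly_pCons rhom_simps[OF CC])
    then consider "q dvd y - CC \<gamma>" | "q dvd poly (map_poly CC s) y"
      using less.prems(2) q by (auto dest: prime_elem_dvd_multD)
    then show ?thesis
    proof cases
      case 2
      then show ?thesis using less.hyps[OF deg s0] s by auto
    qed (use \<gamma> in blast)
  qed
qed

section \<open>Base change to \<open>\<Omega>\<close> and the invariants of the extended map\<close>

context invariant_coordinate
begin

text \<open>\<open>D\<close> is the type \<^typ>\<open>'o poly poly\<close>, with \<open>Y\<close> and \<open>Z\<close> as the inner and the outer variable. The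
  map \<open>\<phi>\<close> is the base change \<open>B \<rightarrow> D\<close>, \<open>CC\<close> embeds the constants, and \<open>\<Delta>\<close> extends \<open>\<delta>\<close> to \<open>D\<close>.\<close>

definition "CC = (\<lambda>\<omega> :: 'o. [:[:\<omega>:]:])"

lemma rhom_CC: "rhom CC"
  unfolding CC_def by (rule rhom_comp[OF rhom_const rhom_const])

definition "\<phi> b = map_poly (map_poly \<rho>) (\<psi> b)"

lemma rhom_\<phi>: "rhom \<phi>"
  unfolding \<phi>_def[abs_def] by (intro rhom_comp[OF _ rhom_\<psi>] rhom_map_poly \<rho>)

abbreviation "\<xi> \<equiv> \<rho> [:0, 1:]"

lemma \<phi>_simps: "\<phi> (const3 a) = CC (\<rho> [:a:])" "\<phi> X = CC \<xi>" "\<phi> Y = x2" "\<phi> Z = x3"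
  unfolding \<phi>_def \<psi>_simps unfolding const3_def CC_def
  by (simp_all add: map_poly_pCons rhom_0[OF \<rho>(1)] rhom_1[OF \<rho>(1)] map_poly_1' one_pCons[symmetric])

lemma \<phi>_\<theta>_\<kappa>: "\<phi> (\<theta> (\<kappa> g)) = CC (\<rho> g)"
  unfolding \<phi>_def \<psi>_\<theta> by (simp add: \<kappa>_def CC_def map_poly_pCons rhom_0[OF \<rho>(1)])

lemma \<phi>_\<kappa>: "\<phi> (\<kappa> a) = poly (map_poly (\<lambda>c. CC (\<rho> [:c:])) a) (\<phi> x1)"
  unfolding \<kappa>_eval by (simp add: rhom_of_poly[OF rhom_\<phi> rhom_const3] \<phi>_simps)

lemma poly_poly_induct:
  fixes d :: "'o poly poly"
  assumes "is_subring S" "\<And>\<omega>. CC \<omega> \<in> S" "x2 \<in> S" "x3 \<in> S"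
  shows "d \<in> S"
proof -
  have 1: "[:g:] \<in> S" for g :: "'o poly"
  proof (induction g)
    case 0 then show ?case using subring_0[OF assms(1)] by simp
  next
    case (pCons a g)
    have "[:pCons a g:] = CC a + x2 * [:g:]" by (simp add: CC_def)
    then show ?case using pCons.IH assms by (simp only:) (intro subring_add subring_mult)
  qed
  show ?thesis
  proof (induction d)
    case 0 then show ?case using subring_0[OF assms(1)] by simp
  next
    case (pCons g d)
    have "pCons g d = [:g:] + x3 * d" by simp
    then show ?case using pCons.IH 1 assms by (simp only:) (intro subring_add subring_mult)
  qed
qed

definition "\<Delta> d = poly (map_poly (\<lambda>g. poly (map_poly (\<lambda>\<omega>. [:CC \<omega>:]) g) (map_poly \<phi> (\<delta> Y))) d)
  (map_poly \<phi> (\<delta> Z))"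

lemma rhom_const_CC: "rhom (\<lambda>\<omega>. [:CC \<omega>:])"
  by (rule rhom_comp[OF rhom_const rhom_CC])

lemma rhom_\<Delta>: "rhom \<Delta>"
  unfolding \<Delta>_def[abs_def] by (intro rhom_map_poly_eval rhom_const_CC)

lemma \<Delta>_simps: "\<Delta> (CC \<omega>) = [:CC \<omega>:]" "\<Delta> x2 = map_poly \<phi> (\<delta> Y)" "\<Delta> x3 = map_poly \<phi> (\<delta> Z)"
proof -
  have "\<Delta> [:[:\<omega>:]:] = [:CC \<omega>:]" by (simp add: \<Delta>_def map_poly_pCons rhom_0[OF rhom_const_CC])
  then show "\<Delta> (CC \<omega>) = [:CC \<omega>:]" by (simp add: CC_def)
qed (simp_all add: \<Delta>_def map_poly_pCons rhom_0[OF rhom_const_CC] rhom_1[OF rhom_const_CC])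

lemma \<Delta>_\<phi>: "\<Delta> (\<phi> b) = map_poly \<phi> (\<delta> b)"
proof (rule rhom_eqI[OF rhom_comp[OF rhom_\<Delta> rhom_\<phi>] rhom_comp[OF rhom_map_poly[OF rhom_\<phi>] rhom] coord])
  show "\<Delta> (\<phi> a) = map_poly \<phi> (\<delta> a)" if "a \<in> scalars" for a
    using that by (auto simp: scalars_const3 \<phi>_simps \<Delta>_simps scal map_poly_pCons rhom_0[OF rhom_\<phi>])
  show "\<Delta> (\<phi> a) = map_poly \<phi> (\<delta> a)" if "a \<in> {X, Y, Z}" for a
    using that by (auto simp: \<phi>_simps \<Delta>_simps X_inv map_poly_pCons rhom_0[OF rhom_\<phi>])
qed

lemma \<Delta>_at_0: "poly (\<Delta> d) 0 = d"
proof -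
  have "d \<in> {d. poly (\<Delta> d) 0 = d}"
  proof (rule poly_poly_induct)
    show "is_subring {d. poly (\<Delta> d) 0 = d}"
      by (rule subring_equalizer[OF rhom_comp[OF rhom_poly rhom_\<Delta>]]) (simp add: rhom_def)
    have "poly (map_poly \<phi> p) 0 = \<phi> (poly p 0)" for p
      by (simp add: rhom_poly_eq[OF rhom_\<phi>] rhom_0[OF rhom_\<phi>])
    then show "x2 \<in> {d. poly (\<Delta> d) 0 = d}" "x3 \<in> {d. poly (\<Delta> d) 0 = d}"
      by (simp_all only: mem_Collect_eq \<Delta>_simps at_0 \<phi>_simps)
  qed (simp add: \<Delta>_simps)
  then show ?thesis by simp
qed

definition "AD = adjoin (range CC) {\<phi> x1, \<phi> F}"

lemma subring_AD: "is_subring AD"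
  unfolding AD_def by (rule adjoin_subring)

lemma AD_gens: "CC \<omega> \<in> AD" "\<phi> x1 \<in> AD" "\<phi> F \<in> AD"
  unfolding AD_def by (auto intro: adjoin_base adjoin_gen)

lemma \<phi>_\<kappa>_AD: "\<phi> (\<kappa> a) \<in> AD"
  unfolding \<phi>_\<kappa> using AD_gens
  by (intro subring_poly[OF subring_AD]) (auto simp: coeff_map_poly rhom_0[OF rhom_CC] rhom_0[OF \<rho>(1)])

lemma \<phi>_in_F_AD: "\<phi> (in_F h) \<in> AD"
  unfolding in_F_def rhom_of_poly[OF rhom_\<phi> rhom_\<kappa>]
  by (intro subring_poly[OF subring_AD] AD_gens)
    (simp add: coeff_map_poly rhom_0[OF rhom_\<phi>] rhom_0[OF rhom_\<kappa>] \<phi>_\<kappa>_AD)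

text \<open>\<open>D\<close> is the tensor product of \<open>\<Omega>\<close> and \<open>B\<close>
  over \<open>k[X]\<close>, and \<open>n\<close> counts the summands of a tensor representation. An
  arbitrary finite index set allows one index to be removed without renumbering.\<close>

definition "rep n d \<longleftrightarrow>
  (\<exists>I \<omega> b. finite (I :: nat set) \<and> card I = n \<and> d = (\<Sum>i\<in>I. CC (\<omega> i) * \<phi> (b i)))"

text \<open>Finite sums of products \<open>CC \<omega> * \<phi> b\<close> form a subring that
  contains the constants and both variables of \<open>D\<close>, the images of \<open>Y\<close> and
  \<open>Z\<close>.\<close>

lemma rep_exists: "\<exists>n. rep n d"
proof -
  define R where "R = {d. \<exists>xs. d = (\<Sum>(\<omega>, b)\<leftarrow>xs. CC \<omega> * \<phi> b)}"
  have R_add: "d + e \<in> R" if de: "d \<in> R" "e \<in> R" for d e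
  proof -
    obtain xs ys where "d = (\<Sum>(\<omega>, b)\<leftarrow>xs. CC \<omega> * \<phi> b)" "e = (\<Sum>(\<omega>, b)\<leftarrow>ys. CC \<omega> * \<phi> b)"
      using de unfolding R_def by blast
    then show ?thesis unfolding R_def by (intro CollectI exI[of _ "xs @ ys"]) simp
  qed
  have R_mult: "CC \<nu> * \<phi> a * d \<in> R" if d: "d \<in> R" for a d \<nu>
  proof -
    obtain xs where xs: "d = (\<Sum>(\<omega>, b)\<leftarrow>xs. CC \<omega> * \<phi> b)" using d unfolding R_def by blast
    have "CC \<nu> * \<phi> a * (\<Sum>(\<omega>, b)\<leftarrow>xs. CC \<omega> * \<phi> b) =
        (\<Sum>(\<omega>, b)\<leftarrow>map (\<lambda>(\<omega>, b). (\<nu> * \<omega>, a * b)) xs. CC \<omega> * \<phi> b)"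
      by (induction xs) (auto simp: rhom_mult[OF rhom_\<phi>] rhom_mult[OF rhom_CC] algebra_simps)
    then show ?thesis unfolding R_def xs by blast
  qed
  have R_1: "1 \<in> R" unfolding R_def
    by (intro CollectI exI[of _ "[(1, 1)]"]) (simp add: rhom_1[OF rhom_\<phi>] rhom_1[OF rhom_CC])
  have R_sum: "(\<Sum>(\<omega>, b)\<leftarrow>xs. CC \<omega> * \<phi> b) * e \<in> R" if "e \<in> R" for xs e
  proof (induction xs)
    case Nil then show ?case unfolding R_def by (intro CollectI exI[of _ "[]"]) simp
  next
    case (Cons x xs)
    obtain \<omega> b where "x = (\<omega>, b)" by force
    then show ?case using R_add[OF R_mult[OF that, of \<omega> b] Cons.IH] by (simp add: distrib_right)
  qed
  have "is_subring R" unfolding is_subring_def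
  proof (intro conjI ballI)
    fix d e assume de: "d \<in> R" "e \<in> R"
    have "d + CC (- 1) * \<phi> 1 * e \<in> R" using R_add R_mult de by blast
    then show "d - e \<in> R" by (simp add: rhom_simps[OF rhom_CC] rhom_1[OF rhom_\<phi>])
    show "d * e \<in> R" using de R_sum unfolding R_def by blast
  qed (rule R_1)
  moreover have "CC \<omega> \<in> R" "\<phi> b \<in> R" for \<omega> b
    using R_mult[OF R_1, of \<omega> 1] R_mult[OF R_1, of 1 b]
    by (simp_all add: rhom_1[OF rhom_\<phi>] rhom_1[OF rhom_CC])
  ultimately have "d \<in> R" by (metis poly_poly_induct \<phi>_simps(3,4))
  then obtain xs where "d = (\<Sum>(\<omega>, b)\<leftarrow>xs. CC \<omega> * \<phi> b)" unfolding R_def by blast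
  then have "d = (\<Sum>i\<in>{..<length xs}. CC (fst (xs ! i)) * \<phi> (snd (xs ! i)))"
    by (simp add: sum_list_sum_nth atLeast0LessThan case_prod_unfold)
  then show ?thesis unfolding rep_def by (intro exI[of _ "length xs"]) (auto intro!: exI[of _ "{..<length xs}"])
qed

text \<open>In a shortest representation \<open>d = \<Sum> \<omega> i \<phi>(b i)\<close> the \<open>\<omega> i\<close> are linearly independent over the
  image of \<open>k[X]\<close>, so that all the \<open>b i\<close> are invariant if \<open>d\<close> is.\<close>

lemma \<Delta>_invariant_AD:
  assumes d: "\<Delta> d = [:d:]"
  shows "d \<in> AD"
proof -
  define n where "n = (LEAST n. rep n d)"
  have "rep n d" using rep_exists unfolding n_def by (metis LeastI_ex)
  then obtain I \<omega> b where I: "finite (I :: nat set)" "card I = n" and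
    dI: "d = (\<Sum>i\<in>I. CC (\<omega> i) * \<phi> (b i))" unfolding rep_def by blast
  have indep: "g j = 0" if j: "j \<in> I" and sum: "(\<Sum>i\<in>I. \<omega> i * \<rho> (g i)) = 0" for g j
  proof (rule ccontr)
    assume "g j \<noteq> 0"
    then have gj: "\<rho> (g j) \<noteq> 0" using \<rho> by (metis injD rhom_0)
    \<comment> \<open>The relation eliminates the summand at \<open>j\<close>: a multiple of it is
      subtracted from the representation, after which \<open>b' j = 0\<close>.\<close>
    define \<omega>' where "\<omega>' i = \<omega> i / \<rho> (g j)" for i
    define b' where "b' i = \<theta> (\<kappa> (g j)) * b i - \<theta> (\<kappa> (g i)) * b j" for i
    have summand: "CC (\<omega>' i) * \<phi> (b' i) = CC (\<omega> i) * \<phi> (b i) - CC (\<omega> i * \<rho> (g i)) * (CC (inverse (\<rho> (g j))) * \<phi> (b j))" for i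
    proof -
      have 1: "CC (\<omega>' i) * CC (\<rho> (g j)) = CC (\<omega> i)"
        using gj by (simp add: \<omega>'_def rhom_mult[OF rhom_CC, symmetric])
      have 2: "CC (\<omega>' i) = CC (\<omega> i) * CC (inverse (\<rho> (g j)))"
        by (simp add: \<omega>'_def divide_inverse rhom_mult[OF rhom_CC])
      have "CC (\<omega>' i) * \<phi> (b' i) =
          CC (\<omega>' i) * CC (\<rho> (g j)) * \<phi> (b i) - CC (\<omega>' i) * (CC (\<rho> (g i)) * \<phi> (b j))"
        unfolding b'_def rhom_diff[OF rhom_\<phi>] rhom_mult[OF rhom_\<phi>] \<phi>_\<theta>_\<kappa>
        by (simp only: right_diff_distrib mult.assoc)
      also have "CC (\<omega>' i) * (CC (\<rho> (g i)) * \<phi> (b j)) =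
          CC (\<omega> i * \<rho> (g i)) * (CC (inverse (\<rho> (g j))) * \<phi> (b j))"
        unfolding 2 rhom_mult[OF rhom_CC] by (simp only: ac_simps)
      finally show ?thesis unfolding 1 .
    qed
    have "(\<Sum>i\<in>I. CC (\<omega>' i) * \<phi> (b' i)) = d - CC (\<Sum>i\<in>I. \<omega> i * \<rho> (g i)) * (CC (inverse (\<rho> (g j))) * \<phi> (b j))"
      unfolding summand sum_subtractf dI rhom_sum[OF rhom_CC] sum_distrib_right ..
    then have "d = (\<Sum>i\<in>I. CC (\<omega>' i) * \<phi> (b' i))" using sum by (simp add: rhom_0[OF rhom_CC])
    also have "\<dots> = (\<Sum>i\<in>I - {j}. CC (\<omega>' i) * \<phi> (b' i))"
      using I(1) j by (subst sum.remove[of _ j]) (auto simp: b'_def rhom_0[OF rhom_\<phi>])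
    finally have "rep (card (I - {j})) d" unfolding rep_def using I(1) by blast
    moreover have "card (I - {j}) < n" using card_Diff1_less[OF I(1) j] I(2) by simp
    ultimately show False using not_less_Least unfolding n_def by blast
  qed
  have inv: "\<delta> (b i) = [:b i:]" if i: "i \<in> I" for i
  proof -
    have "coeff (\<delta> (b i)) m = 0" if "m > 0" for m
    proof -
      \<comment> \<open>Comparing the coefficients of \<open>t^m\<close> and then of the monomials
        in \<open>Y\<close> and \<open>Z\<close> yields linear relations between the
        \<open>\<omega> i\<close> over \<open>k[X]\<close>.\<close>
      have "[:d:] = (\<Sum>i\<in>I. [:CC (\<omega> i):] * map_poly \<phi> (\<delta> (b i)))"
        using d dI by (simp add: rhom_sum[OF rhom_\<Delta>] rhom_mult[OF rhom_\<Delta>] \<Delta>_simps \<Delta>_\<phi>)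
      then have "coeff [:d:] m = (\<Sum>i\<in>I. CC (\<omega> i) * \<phi> (coeff (\<delta> (b i)) m))"
        by (simp add: coeff_sum coeff_map_poly rhom_0[OF rhom_\<phi>])
      then have "(\<Sum>i\<in>I. CC (\<omega> i) * \<phi> (coeff (\<delta> (b i)) m)) = 0"
        using that by (cases m) auto
      then have "coeff (coeff (\<Sum>i\<in>I. CC (\<omega> i) * \<phi> (coeff (\<delta> (b i)) m)) s) t = 0" for s t
        by simp
      then have "(\<Sum>i\<in>I. \<omega> i * \<rho> (coeff (coeff (\<psi> (coeff (\<delta> (b i)) m)) s) t)) = 0" for s t
        by (simp add: coeff_sum CC_def \<phi>_def coeff_map_poly rhom_0[OF \<rho>(1)] rhom_0[OF rhom_map_poly[OF \<rho>(1)]])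
      then have "coeff (coeff (\<psi> (coeff (\<delta> (b i)) m)) s) t = 0" for s t
        by (rule indep[OF i])
      then have "\<psi> (coeff (\<delta> (b i)) m) = 0" by (simp add: poly_eq_iff)
      then show ?thesis using \<theta>_\<psi> by (metis rhom_0 rhom_\<theta>)
    qed
    then have "degree (\<delta> (b i)) = 0" by (metis gr0I leading_coeff_0_iff degree_0)
    then obtain a where "\<delta> (b i) = [:a:]" by (auto elim!: degree_eq_zeroE)
    then show ?thesis using at_0[of "b i"] by simp
  qed
  have "\<phi> (b i) \<in> AD" if i: "i \<in> I" for i
  proof -
    obtain h where "b i = in_F h" using invariants_in_F[OF inv[OF i]] by blast
    then show ?thesis by (simp add: \<phi>_in_F_AD)
  qed
  then show ?thesis unfolding dI by (intro subring_sum[OF subring_AD] subring_mult[OF subring_AD] AD_gens)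
qed

section \<open>Linearity of \<open>U\<close> on the fibres over the roots of
  \<open>c\<close>\<close>

lemma \<Delta>_factor_invariant:
  assumes "\<Delta> (a * b) = [:a * b:]" "a * b \<noteq> 0"
  shows "\<Delta> a = [:a:]"
proof -
  have "\<Delta> a * \<Delta> b = [:a * b:]" using assms(1) by (simp add: rhom_mult[OF rhom_\<Delta>])
  moreover from this have "\<Delta> a \<noteq> 0" "\<Delta> b \<noteq> 0" using assms(2) by auto
  ultimately have "degree (\<Delta> a) + degree (\<Delta> b) = 0" by (metis degree_mult_eq degree_pCons_0)
  then obtain e where "\<Delta> a = [:e:]" by (auto elim!: degree_eq_zeroE)
  then show ?thesis using \<Delta>_at_0[of a] by simp
qed

text \<open>\<open>\<Psi> \<alpha>\<close> is only a lift to \<open>\<Omega>[X2, X3]\<close> of the evaluation of \<open>D\<close> at \<open>X1 = \<alpha>\<close>, \<open>F = \<beta>\<close>: it is compatible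
  with \<open>reduce \<alpha>\<close> modulo \<open>U(\<alpha>, X2) - \<beta>\<close>, where \<open>P(\<alpha>, \<beta>) = X\<close>.\<close>

definition "\<Psi> \<alpha> d = poly (map_poly (\<lambda>g. poly (map_poly CC g) (reduce \<alpha> Y)) d) (reduce \<alpha> Z)"

lemma rhom_\<Psi>: "rhom (\<Psi> \<alpha>)"
  unfolding \<Psi>_def[abs_def] by (intro rhom_map_poly_eval rhom_CC)

lemma \<Psi>_simps: "\<Psi> \<alpha> (CC \<omega>) = CC \<omega>" "\<Psi> \<alpha> x2 = reduce \<alpha> Y" "\<Psi> \<alpha> x3 = reduce \<alpha> Z"
proof -
  have "\<Psi> \<alpha> [:[:\<omega>:]:] = CC \<omega>" by (simp add: \<Psi>_def map_poly_pCons rhom_0[OF rhom_CC])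
  then show "\<Psi> \<alpha> (CC \<omega>) = CC \<omega>" by (simp add: CC_def)
qed (simp_all add: \<Psi>_def map_poly_pCons rhom_0[OF rhom_CC] rhom_1[OF rhom_CC] one_pCons[symmetric])

lemma subring_congruent:
  assumes "rhom f" "rhom g"
  shows "is_subring {b. (w :: 'z::comm_ring_1) dvd f b - g b}"
  unfolding is_subring_def
proof (intro conjI ballI)
  fix a b assume "a \<in> {b. w dvd f b - g b}" "b \<in> {b. w dvd f b - g b}"
  then have w: "w dvd f a - g a" "w dvd f b - g b" by auto
  have "f (a - b) - g (a - b) = (f a - g a) - (f b - g b)"
    by (simp add: rhom_diff[OF assms(1)] rhom_diff[OF assms(2)])
  then show "a - b \<in> {b. w dvd f b - g b}" using dvd_diff[OF w] by simp
  have "f (a * b) - g (a * b) = (f a - g a) * f b + g a * (f b - g b)"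
    by (simp add: rhom_mult[OF assms(1)] rhom_mult[OF assms(2)] algebra_simps)
  then show "a * b \<in> {b. w dvd f b - g b}"
    using dvd_add[OF dvd_mult2[OF w(1)] dvd_mult[OF w(2)]] by simp
qed (simp add: rhom_1[OF assms(1)] rhom_1[OF assms(2)])

text \<open>The prime factor \<open>q\<close> of \<open>x1 - \<alpha>\<close> is an invariant, and
  under \<open>\<Psi> \<alpha>\<close> invariants become constant modulo
  \<open>W = U(\<alpha>, x2) - \<beta>\<close>; for \<open>q\<close> this constant is 0. As
  \<open>q\<close> divides \<open>x2 - r\<close>, it follows that \<open>W\<close> divides
  \<open>x2 - r\<close> and has degree 1.\<close>

lemma fibre_linear:
  assumes \<alpha>: "val \<alpha> c = 0"
  shows "degree (map_poly (val \<alpha>) U) = 1"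
proof -
  define V where "V = map_poly (val \<alpha>) U"
  define Q where "Q = map_poly (val \<alpha>) P"
  have V: "degree V > 0" unfolding V_def by (rule degree_fibre[OF \<alpha>])
  obtain i where i: "i \<ge> 1" "coeff Q i \<noteq> 0"
    using P_nonconstant_on_fibre[OF \<alpha>] by (auto simp: Q_def coeff_map_poly rhom_0[OF rhom_value])
  then have "degree Q > 0" using le_degree[of Q i] by linarith
  then have "degree (Q - [:\<xi>:]) > 0" by (metis degree_pCons_0 degree_diff_le_max diff_add_cancel degree_add_le less_le_not_le not_gr_zero order_refl)
  then obtain \<beta> where "poly (Q - [:\<xi>:]) \<beta> = 0" using alg_closed_imp_poly_has_root by blast
  then have \<beta>: "poly Q \<beta> = \<xi>" by simp
  have Q\<xi>: "Q - [:\<xi>:] \<noteq> 0" using \<open>degree (Q - [:\<xi>:]) > 0\<close> by auto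
  define W where "W = V - [:\<beta>:]"
  have W: "degree W = degree V" using V unfolding W_def by (metis degree_add_eq_left degree_minus degree_pCons_0 diff_conv_add_uminus)
  then obtain r where "poly W r = 0" using alg_closed_imp_poly_has_root V by metis
  then have r: "poly V r = \<beta>" by (simp add: W_def)
  \<comment> \<open>Both maps agree on constants, \<open>Y\<close> and \<open>Z\<close>. At
    \<open>X\<close> they differ by \<open>\<xi> - P(\<alpha>, U(\<alpha>, x2))\<close>, a multiple
    of \<open>W\<close> because \<open>P(\<alpha>, \<beta>) = \<xi>\<close>.\<close>
  have W_reduce: "[:W:] dvd \<Psi> \<alpha> (\<phi> b) - reduce \<alpha> b" for b
  proof -
    let ?S = "{b. [:W:] dvd \<Psi> \<alpha> (\<phi> b) - reduce \<alpha> b}"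
    have S: "is_subring ?S" by (rule subring_congruent[OF rhom_comp[OF rhom_\<Psi> rhom_\<phi>] rhom_reduce])
    have "const3 a \<in> ?S" for a
    proof -
      have "reduce \<alpha> (const3 a) = CC (\<rho> [:a:])"
        using reduce_\<kappa>[of \<alpha> "[:a:]"]
        by (simp add: \<kappa>_def const3_def CC_def root_value_def map_poly_pCons rhom_0[OF \<rho>(1)])
      then show ?thesis by (simp add: \<phi>_simps \<Psi>_simps)
    qed
    moreover have "Y \<in> ?S" "Z \<in> ?S" by (simp_all only: \<phi>_simps \<Psi>_simps mem_Collect_eq diff_self dvd_0_right)
    moreover have "X \<in> ?S"
    proof -
      have "reduce \<alpha> X = [:pcompose Q V:]"
        using reduce_in_F[OF \<alpha>, of P] X_eq unfolding Q_def V_def by simp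
      moreover have "W dvd pcompose Q V - [:\<xi>:]"
      proof -
        have "V - [:\<beta>:] dvd poly (map_poly (\<lambda>a. [:a:]) Q) V - poly (map_poly (\<lambda>a. [:a:]) Q) [:\<beta>:]"
          by (rule poly_diff_dvd)
        moreover have "poly (map_poly (\<lambda>a. [:a:]) Q) [:\<beta>:] = [:\<xi>:]"
          using \<beta> by (simp flip: rhom_poly_eq[OF rhom_const])
        ultimately show ?thesis by (simp add: W_def pcompose_altdef)
      qed
      then have "[:W:] dvd [:[:\<xi>:] - pcompose Q V:]"
        by (auto simp: const_poly_dvd_iff coeff_pCons dvd_diff_commute split: nat.splits)
      ultimately show ?thesis by (simp add: \<phi>_simps \<Psi>_simps) (simp add: CC_def)
    qed
    ultimately have "adjoin scalars {X, Y, Z} \<subseteq> ?S"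
      by (intro adjoin_least[OF S]) (auto simp: scalars_const3)
    then show ?thesis using coord by blast
  qed
  \<comment> \<open>Setting \<open>x2 = r\<close>, a root of \<open>W\<close>, turns the congruence
    modulo \<open>W\<close> into an equality; so \<open>\<chi>\<close> takes \<open>x1\<close>,
    \<open>x2\<close> and \<open>F\<close> to \<open>\<alpha>\<close>, \<open>r\<close> and
    \<open>\<beta>\<close>.\<close>
  define ev where "ev d = map_poly (\<lambda>g. poly g r) (d :: 'o poly poly)" for d
  have ev: "rhom ev" unfolding ev_def[abs_def] by (rule rhom_map_poly[OF rhom_poly])
  have ev_const: "ev [:g:] = [:poly g r:]" and ev_CC: "ev (CC \<omega>) = [:\<omega>:]" for g \<omega>
    by (simp_all add: ev_def CC_def map_poly_pCons)
  have "ev [:W:] = 0" by (simp add: ev_const W_def r)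
  then have ev_W: "ev d = ev e" if "[:W:] dvd d - e" for d e
    using that by (metis dvd_0_left_iff dvdE mult_zero_left rhom_diff[OF ev] rhom_mult[OF ev] eq_iff_diff_eq_0)
  define \<chi> where "\<chi> d = ev (\<Psi> \<alpha> d)" for d
  have \<chi>: "rhom \<chi>" unfolding \<chi>_def[abs_def] by (rule rhom_comp[OF ev rhom_\<Psi>])
  have \<chi>_\<phi>: "\<chi> (\<phi> b) = ev (reduce \<alpha> b)" for b
    unfolding \<chi>_def by (rule ev_W[OF W_reduce])
  have \<chi>_CC: "\<chi> (CC \<omega>) = [:\<omega>:]" for \<omega> by (simp add: \<chi>_def \<Psi>_simps ev_CC)
  have red_x1: "reduce \<alpha> x1 = CC \<alpha>"
    using reduce_\<kappa>[of \<alpha> "[:0, 1:]"]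
    by (simp add: \<kappa>_def CC_def root_value_def map_poly_pCons rhom_0[OF \<rho>(1)] rhom_1[OF \<rho>(1)] one_pCons[symmetric])
  have red_x2: "reduce \<alpha> x2 = x2"
    by (simp add: reduce_def map_poly_pCons rhom_0[OF rhom_value] rhom_1[OF rhom_value])
  have \<chi>_x1: "\<chi> (\<phi> x1) = [:\<alpha>:]" unfolding \<chi>_\<phi> red_x1 by (rule ev_CC)
  have \<chi>_x2: "\<chi> (\<phi> x2) = [:r:]" unfolding \<chi>_\<phi> red_x2 by (simp add: ev_const)
  have \<chi>_F: "\<chi> (\<phi> F) = [:\<beta>:]" unfolding \<chi>_\<phi> reduce_F[OF \<alpha>] by (simp add: ev_const r flip: V_def)
  define u where "u = \<phi> x1 - CC \<alpha>"
  \<comment> \<open>If \<open>x1\<close> became a constant of \<open>\<Omega>\<close>, injectivity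
    of \<open>\<rho>\<close> would give \<open>x1 \<in> k[X]\<close>.\<close>
  have u0: "u \<noteq> 0"
  proof
    assume "u = 0"
    then have eq: "map_poly (map_poly \<rho>) (\<psi> x1) = CC \<alpha>" by (simp add: u_def \<phi>_def)
    have "degree (\<psi> x1) = 0"
      using arg_cong[OF eq, of degree] degree_map_poly_inj[OF rhom_map_poly inj_map_poly, OF \<rho>(1) \<rho>, of "\<psi> x1"]
      by (simp add: CC_def)
    then obtain y where y: "\<psi> x1 = [:y:]" by (auto elim!: degree_eq_zeroE)
    then have eq2: "map_poly \<rho> y = [:\<alpha>:]"
      using eq by (simp add: CC_def map_poly_pCons rhom_0[OF rhom_map_poly[OF \<rho>(1)]])
    have "degree y = 0" using arg_cong[OF eq2, of degree] degree_map_poly_inj[OF \<rho>, of y] by simp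
    then obtain g where "y = [:g:]" by (auto elim!: degree_eq_zeroE)
    then show False using \<psi>_x1_not_\<kappa>[of g] y by (simp add: \<kappa>_def)
  qed
  have "\<chi> u = 0" by (simp add: u_def rhom_diff[OF \<chi>] \<chi>_x1 \<chi>_CC)
  then obtain q where q: "prime_elem q" "q dvd u" "\<chi> q = 0"
    using prime_divisor_in_kernel[OF u0, of \<chi>] rhom_1[OF \<chi>] rhom_mult[OF \<chi>] by blast
  \<comment> \<open>Since \<open>\<chi>\<close> kills \<open>q\<close>, a constant congruent to
    \<open>\<phi> b\<close> modulo \<open>q\<close> must be the value of \<open>\<chi>\<close>
    there. This selects the right root below.\<close>
  have q_root: "\<gamma>' = \<gamma>" if "q dvd \<phi> b - CC \<gamma>'" "\<chi> (\<phi> b) = [:\<gamma>:]" for b \<gamma> \<gamma>'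
  proof -
    have "\<chi> (\<phi> b - CC \<gamma>') = 0" using that(1) q(3) by (auto elim!: dvdE simp: rhom_mult[OF \<chi>])
    then show ?thesis using that(2) by (simp add: rhom_diff[OF \<chi>] \<chi>_CC)
  qed
  have q_\<kappa>: "q dvd \<phi> (\<kappa> a) - CC (val \<alpha> a)" for a
  proof -
    have r0: "rhom (\<lambda>c. CC (\<rho> [:c:]))" by (rule rhom_comp[OF rhom_CC rhom_\<rho>0])
    have "CC (val \<alpha> a) = poly (map_poly (\<lambda>c. CC (\<rho> [:c:])) a) (CC \<alpha>)"
      unfolding root_value_def by (rule rhom_of_poly[OF rhom_CC rhom_\<rho>0])
    then have "u dvd \<phi> (\<kappa> a) - CC (val \<alpha> a)" unfolding \<phi>_\<kappa> u_def by (simp add: poly_diff_dvd)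
    then show ?thesis using q(2) dvd_trans by blast
  qed
  have q_poly: "q dvd poly (map_poly (\<lambda>a. \<phi> (\<kappa> a)) h) y - poly (map_poly CC (map_poly (val \<alpha>) h)) y" for h y
  proof (induction h)
    case (pCons a h)
    have "q dvd (\<phi> (\<kappa> a) - CC (val \<alpha> a)) + y * (poly (map_poly (\<lambda>a. \<phi> (\<kappa> a)) h) y - poly (map_poly CC (map_poly (val \<alpha>) h)) y)"
      by (intro dvd_add q_\<kappa> dvd_mult pCons.IH)
    then show ?case
      by (simp add: map_poly_pCons rhom_0[OF rhom_value] rhom_0[OF rhom_CC] rhom_0[OF rhom_\<kappa>] rhom_0[OF rhom_\<phi>] algebra_simps)
  qed simp
  \<comment> \<open>\<open>q\<close> divides \<open>P(\<alpha>, F) - \<xi>\<close>, hence one of its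
    linear factors \<open>F - \<gamma>\<close>, and \<open>\<chi>\<close> identifies
    \<open>\<gamma>\<close> with \<open>\<beta>\<close>.\<close>
  have qF: "q dvd \<phi> F - CC \<beta>"
  proof -
    have "CC \<xi> = poly (map_poly (\<lambda>a. \<phi> (\<kappa> a)) P) (\<phi> F)"
      using arg_cong[OF X_eq, of \<phi>] unfolding \<phi>_simps in_F_def rhom_of_poly[OF rhom_\<phi> rhom_\<kappa>] .
    then have "q dvd CC \<xi> - poly (map_poly CC Q) (\<phi> F)" using q_poly[of P "\<phi> F"] unfolding Q_def by simp
    then have "q dvd poly (map_poly CC (Q - [:\<xi>:])) (\<phi> F)"
      by (simp add: rhom_diff[OF rhom_map_poly[OF rhom_CC]] map_poly_pCons rhom_0[OF rhom_CC]) (metis dvd_minus_iff minus_diff_eq)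
    then obtain \<gamma> where "q dvd \<phi> F - CC \<gamma>"
      using prime_divides_linear_factor[OF rhom_CC q(1) Q\<xi>] by blast
    then show ?thesis using q_root[OF _ \<chi>_F] by blast
  qed
  \<comment> \<open>As \<open>c(\<alpha>) = 0\<close>, \<open>F\<close> is congruent to
    \<open>U(\<alpha>, x2)\<close> modulo \<open>q\<close>, so \<open>q\<close> divides
    \<open>U(\<alpha>, x2) - \<beta>\<close>; again \<open>\<chi>\<close> selects the linear
    factor.\<close>
  have qx2: "q dvd \<phi> x2 - CC r"
  proof -
    let ?p = "poly (map_poly (\<lambda>a. \<phi> (\<kappa> a)) U) (\<phi> x2)"
    have "\<phi> F = \<phi> (\<kappa> c) * \<phi> x3 + ?p"
      by (subst F_split) (simp only: rhom_add[OF rhom_\<phi>] rhom_mult[OF rhom_\<phi>] rhom_of_poly[OF rhom_\<phi> rhom_\<kappa>])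
    moreover have "q dvd \<phi> (\<kappa> c) * \<phi> x3" using q_\<kappa>[of c] \<alpha> by (simp add: rhom_0[OF rhom_CC])
    ultimately have "q dvd \<phi> F - ?p" by simp
    from dvd_diff[OF dvd_diff[OF qF this] q_poly[of U "\<phi> x2"]]
    have "q dvd (\<phi> F - CC \<beta>) - (\<phi> F - ?p) - (?p - poly (map_poly CC V) (\<phi> x2))"
      unfolding V_def .
    then have "q dvd poly (map_poly CC V) (\<phi> x2) - CC \<beta>" by (simp add: algebra_simps)
    then have "q dvd poly (map_poly CC W) (\<phi> x2)"
      by (simp add: W_def rhom_diff[OF rhom_map_poly[OF rhom_CC]] map_poly_pCons rhom_0[OF rhom_CC])
    moreover have "W \<noteq> 0" using W V by auto
    ultimately obtain \<gamma> where "q dvd \<phi> x2 - CC \<gamma>"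
      using prime_divides_linear_factor[OF rhom_CC q(1)] by blast
    then show ?thesis using q_root[OF _ \<chi>_x2] by blast
  qed
  have "\<Delta> u = [:u:]"
    using x1_inv by (simp add: u_def rhom_diff[OF rhom_\<Delta>] \<Delta>_simps \<Delta>_\<phi> map_poly_pCons rhom_0[OF rhom_\<phi>])
  then have "\<Delta> q = [:q:]" using q(2) u0 \<Delta>_factor_invariant by (auto elim!: dvdE)
  then have "q \<in> AD" by (rule \<Delta>_invariant_AD)
  \<comment> \<open>The generators \<open>x1\<close> and \<open>F\<close> of \<open>AD\<close> over
    the constants become \<open>\<alpha>\<close> and \<open>\<beta>\<close> modulo
    \<open>W\<close>.\<close>
  moreover have "AD \<subseteq> {d. \<exists>\<gamma>. [:W:] dvd \<Psi> \<alpha> d - CC \<gamma>}" (is "_ \<subseteq> ?S")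
    unfolding AD_def
  proof (rule adjoin_least)
    show "is_subring ?S" unfolding is_subring_def
    proof (intro conjI ballI)
      show "1 \<in> ?S" by (intro CollectI exI[of _ 1]) (simp add: rhom_1[OF rhom_\<Psi>] rhom_1[OF rhom_CC])
      fix d e assume "d \<in> ?S" "e \<in> ?S"
      then obtain \<gamma> \<eta> where *: "[:W:] dvd \<Psi> \<alpha> d - CC \<gamma>" "[:W:] dvd \<Psi> \<alpha> e - CC \<eta>" by blast
      have "\<Psi> \<alpha> (d - e) - CC (\<gamma> - \<eta>) = (\<Psi> \<alpha> d - CC \<gamma>) - (\<Psi> \<alpha> e - CC \<eta>)"
        by (simp add: rhom_diff[OF rhom_\<Psi>] rhom_diff[OF rhom_CC])
      then show "d - e \<in> ?S" using dvd_diff[OF *] by (intro CollectI exI[of _ "\<gamma> - \<eta>"]) (simp only:)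
      have "\<Psi> \<alpha> (d * e) - CC (\<gamma> * \<eta>) = (\<Psi> \<alpha> d - CC \<gamma>) * \<Psi> \<alpha> e + CC \<gamma> * (\<Psi> \<alpha> e - CC \<eta>)"
        unfolding rhom_mult[OF rhom_\<Psi>] rhom_mult[OF rhom_CC] by (simp only: algebra_simps)
      then show "d * e \<in> ?S"
        using dvd_add[OF dvd_mult2[OF *(1)] dvd_mult[OF *(2)]]
        by (intro CollectI exI[of _ "\<gamma> * \<eta>"]) (simp only:)
    qed
    have "CC \<omega> \<in> ?S" for \<omega> by (intro CollectI exI[of _ \<omega>]) (simp add: \<Psi>_simps)
    then show "range CC \<subseteq> ?S" by blast
    have "\<phi> x1 \<in> ?S" using W_reduce[of x1] unfolding red_x1 by blast
    moreover have "\<phi> F \<in> ?S"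
    proof -
      have "reduce \<alpha> F - CC \<beta> = [:W:]" by (simp add: reduce_F[OF \<alpha>] CC_def W_def V_def)
      then have "[:W:] dvd (\<Psi> \<alpha> (\<phi> F) - reduce \<alpha> F) + (reduce \<alpha> F - CC \<beta>)"
        by (intro dvd_add W_reduce) simp
      then show ?thesis by (intro CollectI exI[of _ \<beta>]) simp
    qed
    ultimately show "{\<phi> x1, \<phi> F} \<subseteq> ?S" by blast
  qed
  ultimately obtain \<gamma> where \<gamma>: "[:W:] dvd \<Psi> \<alpha> q - CC \<gamma>" by blast
  \<comment> \<open>The constant is read off at \<open>x2 = r\<close>, where both \<open>W\<close>
    and \<open>\<Psi> \<alpha> q\<close> vanish.\<close>
  then have "\<gamma> = 0" using ev_W[OF \<gamma>] q(3) by (simp add: \<chi>_def ev_CC)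
  then have "[:W:] dvd \<Psi> \<alpha> q" using \<gamma> by (simp add: rhom_0[OF rhom_CC])
  moreover obtain z where "\<phi> x2 - CC r = q * z" using qx2 by (rule dvdE)
  ultimately have "[:W:] dvd \<Psi> \<alpha> (\<phi> x2 - CC r)"
    by (simp only: rhom_mult[OF rhom_\<Psi>] dvd_mult2)
  then have "[:W:] dvd \<Psi> \<alpha> (\<phi> x2 - CC r) - (\<Psi> \<alpha> (\<phi> x2) - reduce \<alpha> x2)"
    by (intro dvd_diff W_reduce)
  then have "[:W:] dvd x2 - CC r" by (simp add: rhom_diff[OF rhom_\<Psi>] \<Psi>_simps red_x2)
  then have "[:W:] dvd [:[:- r, 1:]:]" by (simp add: CC_def)
  then have "W dvd [:- r, 1:]" by (auto simp: const_poly_dvd_iff coeff_pCons split: nat.splits)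
  then have "degree W \<le> 1" using dvd_imp_degree_le[of W "[:- r, 1:]"] by simp
  then show ?thesis using W V unfolding V_def by linarith
qed

end

section \<open>Triangular exponential maps\<close>

lemma adjoin_adjoin: "adjoin (adjoin A S) T = adjoin A (S \<union> T)"
proof
  show "adjoin (adjoin A S) T \<subseteq> adjoin A (S \<union> T)"
    by (intro adjoin_least adjoin_subring) (auto intro: adjoin_base adjoin_gen)
  show "adjoin A (S \<union> T) \<subseteq> adjoin (adjoin A S) T"
    by (intro adjoin_least adjoin_subring) (auto intro: adjoin_base adjoin_gen)
qed

lemma adjoin_mono: "G \<subseteq> G' \<Longrightarrow> adjoin A G \<subseteq> adjoin A G'"
  by (intro adjoin_least adjoin_subring) (auto intro: adjoin_base adjoin_gen)

lemma adjoin_scalars_image: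
  assumes h: "rhom h" "\<And>a. h (const3 a) \<in> S" and S: "is_subring S" and G: "h ` G \<subseteq> S"
    and b: "b \<in> adjoin scalars G"
  shows "h b \<in> S"
proof -
  have "adjoin scalars G \<subseteq> {b. h b \<in> S}"
    by (intro adjoin_least subring_vimage[OF h(1) S]) (use h(2) G in \<open>auto simp: scalars_const3\<close>)
  then show ?thesis using b by blast
qed

lemma EXP_scalars:
  assumes "\<delta> \<in> EXP (scalars :: 'k::field poly poly poly set)"
  shows "exponential \<delta>" "\<delta> (const3 a) = [:const3 a:]"
proof -
  have "1 \<in> (scalars :: 'k poly poly poly set)" by (simp add: scalars_def image_iff one_pCons)
  then show "exponential \<delta>" by (rule EXP_exponential[OF assms])
  show "\<delta> (const3 a) = [:const3 a:]" using assms by (auto simp: EXP_def scalars_const3)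
qed

lemma EXP_adjoin_iff:
  assumes "\<delta> \<in> EXP (scalars :: 'k::field poly poly poly set)"
  shows "\<delta> \<in> EXP (adjoin scalars {X}) \<longleftrightarrow> \<delta> X = [:X:]"
proof
  assume "\<delta> \<in> EXP (adjoin scalars {X})"
  then show "\<delta> X = [:X:]" using adjoin_gen[of X "{X}" scalars] by (auto simp: EXP_def)
next
  assume X: "\<delta> X = [:X:]"
  interpret exponential \<delta> by (rule EXP_scalars[OF assms])
  have "adjoin scalars {X} \<subseteq> invariants \<delta>"
    by (intro adjoin_least subring_invariants)
      (use X EXP_scalars(2)[OF assms] in \<open>auto simp: invariants_def scalars_const3\<close>)
  then show "\<delta> \<in> EXP (adjoin scalars {X})" using assms by (auto simp: EXP_def invariants_def)
qed

text \<open>Least rank means the greatest number of invariant coordinates at the head of a system,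
  and an adapted system attains it.\<close>

lemma adapted_maximal:
  assumes \<delta>: "\<delta> \<in> EXP (scalars :: 'k::field poly poly poly set)"
    and ad: "Ys \<in> adapted_coordinate_systems scalars n \<delta>"
    and Xs: "Xs \<in> coordinate_systems scalars n" "m \<le> n" "set (take m Xs) \<subseteq> invariants \<delta>"
  shows "set (take m Ys) \<subseteq> invariants \<delta>"
proof -
  interpret exponential \<delta> by (rule EXP_scalars[OF \<delta>])
  have "adjoin scalars (set (take (n - (n - m)) Xs)) \<subseteq> invariants \<delta>"
    using Xs EXP_scalars(2)[OF \<delta>]
    by (intro adjoin_least subring_invariants) (auto simp: invariants_def scalars_const3)
  then have "rank scalars n \<delta> \<le> n - m"
    unfolding rank_def using Xs by (intro Least_le) auto
  then have "m \<le> n - rank scalars n \<delta>" using Xs(2) by linarith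
  then have "set (take m Ys) \<subseteq> set (take (n - rank scalars n \<delta>) Ys)"
    by (rule set_take_subset_set_take)
  also have "\<dots> \<subseteq> invariants \<delta>"
    using ad unfolding adapted_coordinate_systems_def by (auto intro: adjoin_gen)
  finally show ?thesis .
qed

section \<open>Transport along automorphisms and maps in one variable\<close>

lemma map_poly_shift:
  assumes h: "rhom h"
  shows "map_poly (map_poly h) (shift p) = shift (map_poly h p)"
proof (induction p)
  case 0
  then show ?case by (simp add: rhom_0[OF rhom_shift])
next
  case (pCons a p)
  note hh = rhom_map_poly[OF h] and hhh = rhom_map_poly[OF rhom_map_poly[OF h]]
  show ?case
    by (simp only: shift_pCons map_poly_pCons rhom_0[OF h] rhom_add[OF hhh] rhom_mult[OF hhh]
        pCons.IH rhom_0[OF hh] map_poly_0 rhom_1[OF h] map_poly_1' rhom_1[OF hh])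
      (simp add: map_poly_pCons rhom_0[OF h] rhom_1[OF h] rhom_1[OF hh])?
qed

text \<open>Conjugation by a coordinate automorphism lets any coordinate system be replaced by the
  standard variables.\<close>

lemma exponential_conjugate:
  assumes \<delta>: "exponential \<delta>" and \<theta>: "rhom \<theta>" "bij \<theta>"
  shows "exponential (\<lambda>b. map_poly (inv_into UNIV \<theta>) (\<delta> (\<theta> b)))"
proof -
  interpret exponential \<delta> by (rule \<delta>)
  let ?\<psi> = "inv_into UNIV \<theta>"
  have \<psi>: "rhom ?\<psi>" by (rule rhom_inv[OF \<theta>])
  have \<psi>\<theta>: "?\<psi> (\<theta> b) = b" "\<theta> (?\<psi> d) = d" for b d
    using \<theta>(2) by (auto simp: bij_def surj_f_inv_f)
  show ?thesis
  proof
    show r: "rhom (\<lambda>b. map_poly ?\<psi> (\<delta> (\<theta> b)))"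
      by (rule rhom_comp[OF rhom_comp[OF rhom_map_poly[OF \<psi>] rhom] \<theta>(1)])
    fix x
    show "poly (map_poly ?\<psi> (\<delta> (\<theta> x))) 0 = x"
      using rhom_poly_eq[OF \<psi>, of "\<delta> (\<theta> x)" 0] by (simp add: rhom_0[OF \<psi>] poly_0 \<psi>\<theta>)
    have "map_poly (\<lambda>b. map_poly ?\<psi> (\<delta> (\<theta> b))) (map_poly ?\<psi> (\<delta> (\<theta> x))) =
        map_poly (map_poly ?\<psi>) (map_poly \<delta> (\<delta> (\<theta> x)))"
      by (simp add: map_poly_rhom_comp[OF r \<psi>] map_poly_rhom_comp[OF rhom_map_poly[OF \<psi>] rhom] \<psi>\<theta>)
    then show "map_poly (\<lambda>b. map_poly ?\<psi> (\<delta> (\<theta> b))) (map_poly ?\<psi> (\<delta> (\<theta> x))) =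
        shift (map_poly ?\<psi> (\<delta> (\<theta> x)))"
      by (simp add: action map_poly_shift[OF \<psi>])
  qed
qed

text \<open>Here \<open>\<delta>(b) = b(\<delta>(x3))\<close>, so degrees multiply. If
  \<open>g \<noteq> 0\<close> is the coefficient of \<open>t^i\<close> in
  \<open>\<delta>(x3)\<close>, the action law bounds the degree of \<open>\<delta>(g)\<close> by
  \<open>degree (\<delta> x3) - i\<close>, and with \<open>i \<ge> 1\<close> this forces
  \<open>degree g = 0\<close>.\<close>

lemma exponential_univariate:
  fixes \<delta> :: "'a::idom poly \<Rightarrow> 'a poly poly"
  assumes "exponential \<delta>" and const: "\<And>a. \<delta> [:a:] = [:[:a:]:]"
  shows "degree (\<delta> b) = degree b * degree (\<delta> x3)"
    and "i \<ge> 1 \<Longrightarrow> degree (coeff (\<delta> x3) i) = 0"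
proof -
  interpret exponential \<delta> by (rule assms(1))
  show deg: "degree (\<delta> b) = degree b * degree (\<delta> x3)" for b
  proof -
    have "b = poly (map_poly (\<lambda>a. [:a:]) b) x3" using pcompose_altdef[of b "[:0, 1:]"] by simp
    then have "\<delta> b = poly (map_poly (\<lambda>a. \<delta> [:a:]) b) (\<delta> x3)"
      using rhom_of_poly[OF rhom rhom_const, of b x3] by simp
    also have "\<dots> = pcompose (map_poly (\<lambda>a. [:a:]) b) (\<delta> x3)"
      by (simp add: const pcompose_altdef map_poly_rhom_comp[OF rhom_const rhom_const])
    finally show ?thesis by (simp add: degree_pcompose degree_map_poly_inj[OF rhom_const] inj_def)
  qed
  assume i: "i \<ge> 1"
  let ?g = "coeff (\<delta> x3) i" and ?d = "degree (\<delta> x3)"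
  show "degree ?g = 0"
  proof (cases "?g = 0")
    case False
    then have "i \<le> ?d" by (rule le_degree)
    have "\<delta> ?g = coeff (shift (\<delta> x3)) i"
      using action[of x3] by (metis coeff_map_poly rhom rhom_0)
    moreover have "\<delta> ?g \<noteq> 0" using False poly_0[of ?g] by auto
    ultimately have "i + degree (\<delta> ?g) \<le> ?d" using degree_coeff_shift[of "\<delta> x3" i] by simp
    then have "degree ?g * ?d < ?d" using i \<open>i \<le> ?d\<close> deg[of ?g] by linarith
    then show ?thesis by (cases "degree ?g") auto
  qed simp
qed

lemma eval3_inner:
  shows "eval3 const3 u v w [:[:a:]:] \<in> adjoin scalars {u}"
    and "eval3 const3 u v w [:q:] \<in> adjoin scalars {u, v}"
proof -
  have *: "const3 a \<in> adjoin scalars G" for a G by (intro adjoin_base) (simp add: scalars_const3)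
  have r: "rhom (\<lambda>p. poly (map_poly const3 p) u)" by (rule rhom_map_poly_eval[OF rhom_const3])
  have 1: "poly (map_poly const3 a) u \<in> adjoin scalars G" if "u \<in> G" for a G
    using * that
    by (intro subring_poly adjoin_subring) (auto simp: coeff_map_poly rhom_0[OF rhom_const3] intro: adjoin_gen)
  have "eval3 const3 u v w [:q:] = poly (map_poly (\<lambda>p. poly (map_poly const3 p) u) q) v" for q
    by (simp add: eval3_def map_poly_pCons rhom_0[OF rhom_map_poly_eval[OF r]])
  note 2 = this
  show "eval3 const3 u v w [:[:a:]:] \<in> adjoin scalars {u}"
    unfolding 2 using 1[of "{u}" a] by (simp add: map_poly_pCons rhom_0[OF r])
  show "eval3 const3 u v w [:q:] \<in> adjoin scalars {u, v}"
    unfolding 2 using 1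
    by (intro subring_poly adjoin_subring) (auto simp: coeff_map_poly rhom_0[OF r] intro: adjoin_gen)
qed

text \<open>In the coordinates \<open>X, Y, Z\<close> the map acts on polynomials in
  \<open>Z\<close> over \<open>k[X, Y]\<close>, where degrees multiply: \<open>Z\<close> is a local
  slice unless it is fixed, and the coefficients of \<open>\<delta>(Z) - Z\<close> lie in
  \<open>k[X, Y]\<close>.\<close>

lemma two_invariant_coordinates_triangular:
  fixes \<delta> :: "'k::field poly poly poly \<Rightarrow> 'k poly poly poly poly"
  assumes \<delta>: "\<delta> \<in> EXP scalars" and coord: "adjoin scalars {X, Y, Z} = UNIV"
    and X: "\<delta> X = [:X:]" and Y: "\<delta> Y = [:Y:]"
  shows "triangular (adjoin scalars {X}) 2 \<delta>"
proof -
  interpret exponential \<delta> by (rule EXP_scalars[OF \<delta>])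
  define \<theta> where "\<theta> = eval3 const3 X Y Z"
  have \<theta>: "rhom \<theta>" "bij \<theta>"
    unfolding \<theta>_def by (rule rhom_eval3[OF rhom_const3], rule bij_eval3[OF coord])
  have \<theta>x: "\<theta> (const3 a) = const3 a" "\<theta> x1 = X" "\<theta> x2 = Y" "\<theta> x3 = Z" for a
    unfolding \<theta>_def by (simp_all only: eval3_simps[OF rhom_const3])
  let ?\<psi> = "inv_into UNIV \<theta>"
  have \<psi>: "rhom ?\<psi>" "inj ?\<psi>" using rhom_inv[OF \<theta>] \<theta>(2) by (auto simp: bij_is_inj bij_imp_bij_inv)
  have \<psi>\<theta>: "?\<psi> (\<theta> b) = b" "\<theta> (?\<psi> b) = b" for b
    using \<theta>(2) by (auto simp: bij_def surj_f_inv_f)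
  let ?e = "\<lambda>b. map_poly ?\<psi> (\<delta> (\<theta> b))"
  have e: "exponential ?e" by (rule exponential_conjugate[OF exponential_axioms \<theta>])
  have const: "?e [:q:] = [:[:q:]:]" for q
  proof -
    have "adjoin scalars {X, Y} \<subseteq> invariants \<delta>"
      using EXP_scalars(2)[OF \<delta>] X Y
      by (intro adjoin_least subring_invariants) (auto simp: invariants_def scalars_const3)
    then have "\<delta> (\<theta> [:q:]) = [:\<theta> [:q:]:]"
      using eval3_inner(2)[of X Y Z q] unfolding \<theta>_def by (auto simp: invariants_def)
    then show ?thesis by (simp add: map_poly_pCons rhom_0[OF \<psi>(1)] \<psi>\<theta>)
  qed
  have slice: "local_slice \<delta> Z" if "\<delta> Z \<noteq> [:Z:]"
    unfolding local_slice_def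
  proof (intro conjI allI impI)
    show "0 < degree (\<delta> Z)" using that invariant_iff[of Z] by (auto simp: invariants_def)
    fix y assume "0 < degree (\<delta> y)"
    moreover have "degree (\<delta> y) = degree (?\<psi> y) * degree (\<delta> Z)"
      using exponential_univariate(1)[OF e const, of "?\<psi> y"] unfolding degree_map_poly_inj[OF \<psi>] \<theta>x \<psi>\<theta> .
    ultimately show "degree (\<delta> Z) \<le> degree (\<delta> y)" by (cases "degree (?\<psi> y)") auto
  qed
  have coeffs: "coeff (\<delta> Z - [:Z:]) j \<in> adjoin scalars {X, Y}" for j
  proof (cases j)
    case 0
    then show ?thesis using coeff_0[of Z] subring_0[OF adjoin_subring] by simp
  next
    case (Suc i)
    have "degree (coeff (?e x3) j) = 0"
      using exponential_univariate(2)[OF e const, of j] Suc by simp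
    then obtain q where "coeff (?e x3) j = [:q:]" by (auto elim!: degree_eq_zeroE)
    then have "?\<psi> (coeff (\<delta> Z) j) = [:q:]" by (simp only: \<theta>x coeff_map_poly rhom_0[OF \<psi>(1)])
    then have "coeff (\<delta> Z) j = \<theta> [:q:]" using \<psi>\<theta>(2) by metis
    then show ?thesis using Suc eval3_inner(2)[of X Y Z q] by (simp add: \<theta>_def)
  qed
  have "coeff (\<delta> ([Y, Z] ! i) - [:[Y, Z] ! i:]) j \<in> adjoin (adjoin scalars {X}) (set (take i [Y, Z]))"
    if "i < 2" for i j
    using that coeffs[of j] Y
    by (cases i) (auto simp: less_Suc_eq adjoin_adjoin subring_0[OF adjoin_subring] insert_commute)
  moreover have "coeff (\<delta> ([Y, Z] ! i) - [:[Y, Z] ! i:]) 0 = 0" for i by (simp add: coeff_0)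
  moreover have "local_slice \<delta> ([Y, Z] ! i)" if "i < 2" "\<delta> ([Y, Z] ! i) \<noteq> [:[Y, Z] ! i:]" for i
    using that slice Y by (cases i) (auto simp: less_Suc_eq)
  moreover have "[Y, Z] \<in> coordinate_systems (adjoin scalars {X}) 2"
    using coord by (simp add: coordinate_systems_def adjoin_adjoin)
  ultimately show ?thesis
    unfolding triangular_def using EXP_adjoin_iff[OF \<delta>] X by blast
qed


section \<open>Triangular maps that move the first coordinate\<close>

lemma lead_coeff_moved:
  assumes "exponential \<delta>" "degree (\<delta> x) > 0" "\<And>j. coeff (\<delta> x - [:x:]) j \<in> S"
  shows "lead_coeff (\<delta> x) \<in> S"
  using assms(2) assms(3)[of "degree (\<delta> x)"] by (simp add: coeff_pCons split: nat.splits)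

lemma coeffs_moved:
  assumes \<delta>: "exponential \<delta>" and S: "is_subring S" "x \<in> S" "\<And>j. coeff (\<delta> x - [:x:]) j \<in> S"
  shows "coeff (\<delta> x) j \<in> S"
proof -
  have "coeff (\<delta> x - [:x:]) j + coeff [:x:] j \<in> S"
    using S by (intro subring_add) (auto simp: coeff_pCons subring_0 split: nat.splits)
  then show ?thesis by simp
qed

text \<open>The leading coefficient of \<open>\<delta>(X1)\<close> is a unit, so the slice lemma needs no denominators.\<close>

lemma moved_first_coordinate:
  fixes \<delta> :: "'k::field poly poly poly \<Rightarrow> 'k poly poly poly poly"
  assumes \<delta>: "\<delta> \<in> EXP scalars" and coord: "adjoin scalars {X1, X2, X3} = UNIV"
    and slice: "local_slice \<delta> X1"
    and c1: "\<And>j. coeff (\<delta> X1 - [:X1:]) j \<in> scalars"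
    and c2: "\<And>j. coeff (\<delta> X2 - [:X2:]) j \<in> adjoin scalars {X1}"
    and c3: "\<And>j. coeff (\<delta> X3 - [:X3:]) j \<in> adjoin scalars {X1, X2}"
  shows "\<exists>V W. \<delta> V = [:V:] \<and> \<delta> W = [:W:] \<and> adjoin scalars {V, W, X1} = UNIV"
proof -
  interpret exponential \<delta> by (rule EXP_scalars[OF \<delta>])
  have sc: "const3 a \<in> adjoin scalars G" for a G by (intro adjoin_base) (simp add: scalars_const3)
  have deg: "degree (\<delta> X1) > 0" using slice by (simp add: local_slice_def)
  obtain a where a: "lead_coeff (\<delta> X1) = const3 a"
    using lead_coeff_moved[OF exponential_axioms deg c1] by (auto simp: scalars_const3)
  have "lead_coeff (\<delta> X1) \<noteq> 0" using deg by auto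
  then have "a \<noteq> 0" unfolding a by (auto simp: const3_def)
  then have unit: "const3 (inverse a ^ N) * (const3 a ^ N * y) = y" for N y
    by (simp add: rhom_power[OF rhom_const3, symmetric] mult.assoc[symmetric]
        rhom_mult[OF rhom_const3, symmetric] power_mult_distrib[symmetric] rhom_1[OF rhom_const3])
  have inv: "lead_coeff (\<delta> X1) \<in> invariants \<delta>"
    unfolding a invariants_def using EXP_scalars(2)[OF \<delta>] by simp
  have X1S: "coeff (\<delta> X1) j \<in> adjoin scalars G" if "X1 \<in> G" for j G
    using c1 that
    by (intro coeffs_moved[OF exponential_axioms adjoin_subring]) (auto intro: adjoin_base adjoin_gen)
  obtain N s where s: "s \<in> adjoin scalars {X1}" "const3 a ^ N * X2 + s \<in> invariants \<delta>"
    using slice_invariant[OF slice adjoin_subring X1S inv c2] unfolding a by blast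
  obtain M r where r: "r \<in> adjoin scalars {X1, X2}" "const3 a ^ M * X3 + r \<in> invariants \<delta>"
    using slice_invariant[OF slice adjoin_subring X1S inv c3] unfolding a by blast
  define V W where "V = const3 a ^ N * X2 + s" and "W = const3 a ^ M * X3 + r"
  let ?S = "adjoin scalars {V, W, X1}"
  have S: "is_subring ?S" by (rule adjoin_subring)
  have gens: "V \<in> ?S" "W \<in> ?S" "X1 \<in> ?S" by (auto intro: adjoin_gen)
  have "s \<in> ?S" using s(1) adjoin_mono[of "{X1}" "{V, W, X1}"] by blast
  then have "const3 (inverse a ^ N) * (V - s) \<in> ?S"
    by (intro subring_mult[OF S] subring_diff[OF S] sc gens)
  then have X2: "X2 \<in> ?S" using unit by (simp add: V_def)
  have "adjoin scalars {X1, X2} \<subseteq> ?S"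
    using gens X2 by (intro adjoin_least S) (auto intro: adjoin_base)
  then have "const3 (inverse a ^ M) * (W - r) \<in> ?S"
    using r(1) by (intro subring_mult[OF S] subring_diff[OF S] sc gens) blast
  then have X3: "X3 \<in> ?S" using unit by (simp add: W_def)
  have "adjoin scalars {X1, X2, X3} \<subseteq> ?S"
    using gens X2 X3 by (intro adjoin_least S) (auto intro: adjoin_base)
  then have "?S = UNIV" using coord by blast
  moreover have "\<delta> V = [:V:]" "\<delta> W = [:W:]" using s(2) r(2) by (simp_all add: V_def W_def invariants_def)
  ultimately show ?thesis by blast
qed

section \<open>Triangular maps that fix the first coordinate\<close>

instance alg_closure :: (field) field_gcd ..

text \<open>The embedding of \<open>k[X]\<close> into the algebraic closure of \<open>k(X)\<close>,
  which serves as \<open>\<Omega>\<close>; its instance of \<open>field_gcd\<close> makes polynomial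
  rings over it factorial.\<close>

definition generic_hom :: "'k::field poly \<Rightarrow> 'k poly fract alg_closure" where
  "generic_hom p = to_ac (to_fract p)"

lemma rhom_generic_hom: "rhom generic_hom" and inj_generic_hom: "inj generic_hom"
  unfolding generic_hom_def[abs_def] by (auto intro!: rhomI injI)

text \<open>Choosing \<open>F = c x3 + U(x1, x2)\<close> invariant with \<open>c\<close> of least degree makes \<open>U\<close> nonconstant
  at the roots of \<open>c\<close>.\<close>

lemma standard_coordinates_dichotomy:
  fixes \<delta> :: "'k::field poly poly poly \<Rightarrow> 'k poly poly poly poly"
  assumes \<delta>: "exponential \<delta>" and scal: "\<And>a. \<delta> (const3 a) = [:const3 a:]"
    and x1: "\<delta> x1 = [:x1:]" and x2: "degree (\<delta> x2) > 0"
    and F: "c \<noteq> 0" "\<delta> [:U, [:c:]:] = [:[:U, [:c:]:]:]"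
    and coord: "adjoin scalars {X, Y, Z} = UNIV" and X: "\<delta> X = [:X:]"
  shows "X \<in> range (\<lambda>a. [:[:a:]:]) \<or>
    (\<exists>F T. \<delta> F = [:F:] \<and> adjoin scalars {x1, F, T} = UNIV)"
proof (rule disjCI)
  interpret exponential \<delta> by (rule \<delta>)
  assume no: "\<not> (\<exists>F T. \<delta> F = [:F:] \<and> adjoin scalars {x1, F, T} = UNIV)"
  let ?Q = "\<lambda>(c, U). c \<noteq> 0 \<and> \<delta> [:U, [:c:]:] = [:[:U, [:c:]:]:]"
  obtain c U where c: "c \<noteq> 0" and F: "\<delta> [:U, [:c:]:] = [:[:U, [:c:]:]:]"
    and least: "\<And>c' U'. c' \<noteq> 0 \<Longrightarrow> \<delta> [:U', [:c':]:] = [:[:U', [:c':]:]:] \<Longrightarrow> degree c \<le> degree c'"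
    using ex_has_least_nat[of ?Q "(c, U)" "\<lambda>(c, U). degree c"] F by auto
  let ?\<rho>0 = "\<lambda>a :: 'k. generic_hom [:a:]"
  have \<rho>0: "rhom ?\<rho>0" by (rule rhom_comp[OF rhom_generic_hom rhom_const])
  have nonconst: "\<exists>i\<ge>1. root_value ?\<rho>0 \<alpha> (coeff U i) \<noteq> 0" if \<alpha>: "root_value ?\<rho>0 \<alpha> c = 0" for \<alpha>
  proof (rule ccontr)
    assume const: "\<not> ?thesis"
    obtain p where p: "p \<noteq> 0" "\<And>g. root_value ?\<rho>0 \<alpha> g = 0 \<longleftrightarrow> p dvd g"
      using minimal_polynomial[OF \<rho>0 c \<alpha>] by blast
    obtain c' where c': "c = p * c'" using p \<alpha> by (auto elim: dvdE)
    \<comment> \<open>If \<open>U(\<alpha>, x2)\<close> is constant, \<open>p\<close> divides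
      \<open>U - u\<close> as well as \<open>c\<close>; then \<open>(F - u) / p\<close> is invariant
      too, and its coefficient \<open>c'\<close> has smaller degree than \<open>c\<close>.\<close>
    define u where "u = coeff U 0"
    have "p dvd coeff (U - [:u:]) i" for i
      using const p(2) by (cases i) (auto simp: u_def)
    then have "[:p:] dvd U - [:u:]" by (simp add: const_poly_dvd_iff)
    then obtain U' where U': "U - [:u:] = smult p U'" by (auto elim!: dvdE)
    have U: "U = [:u:] + smult p U'" using U' by (simp add: algebra_simps)
    have \<delta>\<kappa>: "\<delta> [:[:a:]:] = [:[:[:a:]:]:]" for a
    proof -
      have "[:[:a:]:] \<in> {b. \<delta> b = [:b:]}"
        using inner_poly_eval[of a]
          subring_poly[OF subring_equalizer[OF rhom rhom_const], of "map_poly const3 a" x1]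
        by (simp add: coeff_map_poly rhom_0[OF rhom_const3] scal x1)
      then show ?thesis by simp
    qed
    have split: "[:U, [:c:]:] = [:[:u:]:] + [:[:p:]:] * [:U', [:c':]:]" by (simp add: U c')
    have "[:[:[:p:]:]:] * \<delta> [:U', [:c':]:] = [:[:[:p:]:]:] * [:[:U', [:c':]:]:]"
    proof -
      have "\<delta> ([:[:u:]:] + [:[:p:]:] * [:U', [:c':]:]) = [:[:[:u:]:] + [:[:p:]:] * [:U', [:c':]:]:]"
        using F unfolding split .
      then have "[:[:[:u:]:]:] + [:[:[:p:]:]:] * \<delta> [:U', [:c':]:] =
          [:[:[:u:]:]:] + [:[:[:p:]:]:] * [:[:U', [:c':]:]:]"
        unfolding rhom_add[OF rhom] rhom_mult[OF rhom] \<delta>\<kappa> rhom_add[OF rhom_const] rhom_mult[OF rhom_const] .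
      then show ?thesis by (rule add_left_imp_eq)
    qed
    then have "\<delta> [:U', [:c':]:] = [:[:U', [:c':]:]:]"
      using p(1) by (subst (asm) mult_cancel_left) simp
    moreover have "c' \<noteq> 0" using c c' by auto
    ultimately have "degree c \<le> degree c'" using least by blast
    then have "degree p = 0" using c c' by (auto simp: degree_mult_eq)
    then have "p dvd 1" using p(1) is_unit_iff_degree by blast
    then show False using p(2)[of 1] by (simp add: rhom_1[OF rhom_root_value[OF \<rho>0]])
  qed
  show "X \<in> range (\<lambda>a. [:[:a:]:])"
  proof (rule ccontr)
    assume new: "X \<notin> range (\<lambda>a. [:[:a:]:])"
    interpret ic: invariant_coordinate \<delta> c U X Y Z generic_hom
      by unfold_locales
        (use rhom poly_0 scal x1 x2 F c coord X new rhom_generic_hom inj_generic_hom nonconst in auto)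
    have lin: "degree (map_poly (root_value ?\<rho>0 \<alpha>) U) = 1" if "root_value ?\<rho>0 \<alpha> c = 0" for \<alpha>
      by (rule ic.fibre_linear[OF that])
    have co: "root_value ?\<rho>0 \<alpha> (coeff U i) = coeff (map_poly (root_value ?\<rho>0 \<alpha>) U) i" for \<alpha> i
      by (simp add: coeff_map_poly rhom_0[OF rhom_root_value[OF \<rho>0]])
    have "\<exists>T. adjoin scalars {x1, [:U, [:c:]:], T} = UNIV"
    proof (rule linear_fibres_coordinate[OF \<rho>0 c])
      fix \<alpha> assume \<alpha>: "root_value ?\<rho>0 \<alpha> c = 0"
      show "root_value ?\<rho>0 \<alpha> (coeff U 1) \<noteq> 0"
        unfolding co using lin[OF \<alpha>] by (metis leading_coeff_0_iff degree_0 zero_neq_one)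
      show "root_value ?\<rho>0 \<alpha> (coeff U i) = 0" if "2 \<le> i" for i
        unfolding co using lin[OF \<alpha>] that by (intro coeff_eq_0) simp
    qed
    then show False using no F by blast
  qed
qed

text \<open>Degrees in \<open>Y\<close> and \<open>Z\<close> show that a coordinate \<open>X \<in> k[X1]\<close> generates \<open>k[X1]\<close>.\<close>

lemma coordinate_in_univariate_subring:
  fixes X :: "'k::field poly poly poly"
  assumes coord: "adjoin scalars {X, Y, Z} = UNIV" and X: "X \<in> adjoin scalars {X1}"
  shows "adjoin scalars {X} = adjoin scalars {X1}"
proof
  show "adjoin scalars {X} \<subseteq> adjoin scalars {X1}"
    using X by (intro adjoin_least adjoin_subring) (auto intro: adjoin_base)
  define \<theta> where "\<theta> = eval3 const3 X Y Z"
  have \<theta>: "rhom \<theta>" "bij \<theta>"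
    unfolding \<theta>_def by (rule rhom_eval3[OF rhom_const3], rule bij_eval3[OF coord])
  have \<theta>x: "\<theta> (const3 a) = const3 a" "\<theta> x1 = X" for a
    unfolding \<theta>_def by (simp_all only: eval3_simps[OF rhom_const3])
  let ?\<psi> = "inv_into UNIV \<theta>"
  have \<psi>: "rhom ?\<psi>" by (rule rhom_inv[OF \<theta>])
  have \<psi>\<theta>: "?\<psi> (\<theta> b) = b" "\<theta> (?\<psi> b) = b" for b
    using \<theta>(2) by (auto simp: bij_def surj_f_inv_f)
  define y where "y = ?\<psi> X1"
  have r2: "rhom (\<lambda>a :: 'k. [:[:a:]:])" by (rule rhom_comp[OF rhom_const rhom_const])
  have ex: "?\<psi> b \<in> range (\<lambda>g. poly (map_poly const3 g) y)" if "b \<in> adjoin scalars {X1}" for b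
  proof (rule adjoin_scalars_image[OF \<psi> _ subring_range[OF rhom_map_poly_eval[OF rhom_const3]] _ that])
    show "?\<psi> (const3 a) \<in> range (\<lambda>g. poly (map_poly const3 g) y)" for a
      using \<psi>\<theta>(1)[of "const3 a"] unfolding \<theta>x
      by (intro range_eqI[of _ _ "[:a:]"]) (simp add: map_poly_pCons rhom_0[OF rhom_const3])
    show "?\<psi> ` {X1} \<subseteq> range (\<lambda>g. poly (map_poly const3 g) y)"
      by (auto intro!: range_eqI[of _ _ "[:0, 1:]"]
          simp: y_def map_poly_pCons rhom_0[OF rhom_const3] rhom_1[OF rhom_const3])
  qed
  have "?\<psi> X = x1" using \<psi>\<theta>(1)[of x1] unfolding \<theta>x .
  \<comment> \<open>Thus \<open>x1 = g(y)\<close>, where \<open>y\<close> expresses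
    \<open>X1\<close> in \<open>X, Y, Z\<close>. As \<open>x1\<close> has degree 0 in the variables
    for \<open>Z\<close> and \<open>Y\<close>, so has \<open>y\<close>.\<close>
  then obtain g where g: "x1 = poly (map_poly const3 g) y" using ex[OF X] by auto
  have deg_g: "degree g \<noteq> 0"
  proof
    assume "degree g = 0"
    then obtain a where "g = [:a:]" by (auto elim!: degree_eq_zeroE)
    then show False using g by (simp add: map_poly_pCons rhom_0[OF rhom_const3]) (simp add: const3_def)
  qed
  have "poly (map_poly const3 g) y = pcompose (map_poly (\<lambda>a. [:[:a:]:]) g) y"
    by (simp add: pcompose_altdef map_poly_rhom_comp[OF rhom_const r2] const3_def[abs_def])
  then have "degree (poly (map_poly const3 g) y) = degree g * degree y"
    by (simp add: degree_pcompose degree_map_poly_inj[OF r2 rhom_field_inj[OF r2]])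
  moreover have "degree (poly (map_poly const3 g) y) = 0" using arg_cong[OF g, of degree] by simp
  ultimately have "degree y = 0" using deg_g by simp
  then obtain z where z: "y = [:z:]" by (auto elim!: degree_eq_zeroE)
  have "poly (map_poly const3 g) y = [:poly (map_poly (\<lambda>a. [:[:a:]:]) g) z:]"
    unfolding z by (subst rhom_of_poly[OF rhom_const r2]) (simp add: const3_def[abs_def])
  then have g2: "[:[:0, 1:]:] = poly (map_poly (\<lambda>a. [:[:a:]:]) g) z" using g by simp
  have "poly (map_poly (\<lambda>a. [:[:a:]:]) g) z = pcompose (map_poly (\<lambda>a. [:a:]) g) z"
    by (simp add: pcompose_altdef map_poly_rhom_comp[OF rhom_const rhom_const])
  then have "degree (poly (map_poly (\<lambda>a. [:[:a:]:]) g) z) = degree g * degree z"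
    by (simp add: degree_pcompose degree_map_poly_inj[OF rhom_const] inj_def)
  moreover have "degree (poly (map_poly (\<lambda>a. [:[:a:]:]) g) z) = 0" using arg_cong[OF g2, of degree] by simp
  ultimately have "degree z = 0" using deg_g by simp
  then obtain h where h: "z = [:h:]" by (auto elim!: degree_eq_zeroE)
  have "X1 = \<theta> [:[:h:]:]" using \<psi>\<theta>(2)[of X1] z h by (simp add: y_def)
  then have "X1 \<in> adjoin scalars {X}" using eval3_inner(1)[of X Y Z h] by (simp add: \<theta>_def)
  then show "adjoin scalars {X1} \<subseteq> adjoin scalars {X}"
    by (intro adjoin_least adjoin_subring) (auto intro: adjoin_base)
qed


text \<open>The slice lemma for \<open>X2\<close> yields the invariant
  \<open>c(X1) X3 + U(X1, X2)\<close>, with \<open>c\<close> a power of the leading coefficient of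
  \<open>\<delta>(X2)\<close>; conjugation then reduces the claim to the standard variables.\<close>

lemma moved_second_coordinate:
  fixes \<delta> :: "'k::field poly poly poly \<Rightarrow> 'k poly poly poly poly"
  assumes \<delta>: "\<delta> \<in> EXP scalars" and coord1: "adjoin scalars {X1, X2, X3} = UNIV"
    and X1: "\<delta> X1 = [:X1:]" and slice: "local_slice \<delta> X2"
    and c2: "\<And>j. coeff (\<delta> X2 - [:X2:]) j \<in> adjoin scalars {X1}"
    and c3: "\<And>j. coeff (\<delta> X3 - [:X3:]) j \<in> adjoin scalars {X1, X2}"
    and coord: "adjoin scalars {X, Y, Z} = UNIV" and X: "\<delta> X = [:X:]"
  shows "X \<in> adjoin scalars {X1} \<or>
    (\<exists>F T. \<delta> F = [:F:] \<and> adjoin scalars {X1, F, T} = UNIV)"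
proof -
  interpret exponential \<delta> by (rule EXP_scalars[OF \<delta>])
  note scal = EXP_scalars(2)[OF \<delta>]
  define \<theta> where "\<theta> = eval3 const3 X1 X2 X3"
  have \<theta>: "rhom \<theta>" "bij \<theta>"
    unfolding \<theta>_def by (rule rhom_eval3[OF rhom_const3], rule bij_eval3[OF coord1])
  have \<theta>x: "\<theta> (const3 a) = const3 a" "\<theta> x1 = X1" "\<theta> x2 = X2" "\<theta> x3 = X3" for a
    unfolding \<theta>_def by (simp_all only: eval3_simps[OF rhom_const3])
  let ?\<psi> = "inv_into UNIV \<theta>"
  have \<psi>: "rhom ?\<psi>" "inj ?\<psi>" using rhom_inv[OF \<theta>] \<theta>(2) by (auto simp: bij_is_inj bij_imp_bij_inv)
  have \<psi>\<theta>: "?\<psi> (\<theta> b) = b" "\<theta> (?\<psi> b) = b" for b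
    using \<theta>(2) by (auto simp: bij_def surj_f_inv_f)
  have \<psi>x: "?\<psi> (const3 a) = const3 a" "?\<psi> X1 = x1" "?\<psi> X2 = x2" "?\<psi> X3 = x3" for a
    using \<psi>\<theta>(1) \<theta>x by metis+
  define e where "e b = map_poly ?\<psi> (\<delta> (\<theta> b))" for b
  have e: "exponential e"
    unfolding e_def[abs_def] by (rule exponential_conjugate[OF exponential_axioms \<theta>])
  have e_inv: "e b = [:b:] \<longleftrightarrow> \<delta> (\<theta> b) = [:\<theta> b:]" for b
  proof
    assume "e b = [:b:]"
    then have "map_poly ?\<psi> (\<delta> (\<theta> b)) = map_poly ?\<psi> [:\<theta> b:]"
      by (simp add: e_def map_poly_pCons rhom_0[OF \<psi>(1)] \<psi>\<theta>)
    then show "\<delta> (\<theta> b) = [:\<theta> b:]" using inj_map_poly[OF \<psi>] by (rule injD[rotated])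
  qed (simp add: e_def map_poly_pCons rhom_0[OF \<psi>(1)] \<psi>\<theta>)
  have in1: "?\<psi> b \<in> range (\<lambda>a. [:[:a:]:])" if "b \<in> adjoin scalars {X1}" for b
  proof (rule adjoin_scalars_image[OF \<psi>(1) _ subring_range[OF rhom_comp[OF rhom_const rhom_const]] _ that])
    show "?\<psi> (const3 a) \<in> range (\<lambda>a. [:[:a:]:])" for a unfolding \<psi>x by (simp add: const3_def)
    show "?\<psi> ` {X1} \<subseteq> range (\<lambda>a. [:[:a:]:])" using \<psi>x by simp
  qed
  have in2: "?\<psi> b \<in> range (\<lambda>q. [:q:])" if "b \<in> adjoin scalars {X1, X2}" for b
  proof (rule adjoin_scalars_image[OF \<psi>(1) _ subring_range[OF rhom_const] _ that])
    show "?\<psi> (const3 a) \<in> range (\<lambda>q. [:q:])" for a unfolding \<psi>x by (simp add: const3_def)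
    show "?\<psi> ` {X1, X2} \<subseteq> range (\<lambda>q. [:q:])" using \<psi>x by auto
  qed
  have deg: "degree (\<delta> X2) > 0" using slice by (simp add: local_slice_def)
  have lc: "lead_coeff (\<delta> X2) \<in> adjoin scalars {X1}"
    by (rule lead_coeff_moved[OF exponential_axioms deg c2])
  have "adjoin scalars {X1} \<subseteq> invariants \<delta>"
    using scal X1 by (intro adjoin_least subring_invariants) (auto simp: invariants_def scalars_const3)
  then have inv: "lead_coeff (\<delta> X2) \<in> invariants \<delta>" using lc by blast
  have X2S: "coeff (\<delta> X2) j \<in> adjoin scalars {X1, X2}" for j
    using c2 adjoin_mono[of "{X1}" "{X1, X2}" scalars]
    by (intro coeffs_moved[OF exponential_axioms adjoin_subring]) (auto intro: adjoin_gen)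
  obtain N s where s: "s \<in> adjoin scalars {X1, X2}" "lead_coeff (\<delta> X2) ^ N * X3 + s \<in> invariants \<delta>"
    using slice_invariant[OF slice adjoin_subring X2S inv c3] by blast
  obtain c where c: "?\<psi> (lead_coeff (\<delta> X2) ^ N) = [:[:c:]:]"
    using in1[OF subring_power[OF adjoin_subring lc]] by blast
  obtain U where U: "?\<psi> s = [:U:]" using in2[OF s(1)] by blast
  have c0: "c \<noteq> 0"
  proof
    assume "c = 0"
    then have "lead_coeff (\<delta> X2) ^ N = 0"
      using c \<psi>\<theta>(2)[of "lead_coeff (\<delta> X2) ^ N"] by (simp add: rhom_0[OF \<theta>(1)])
    then show False using deg by auto
  qed
  have "[:U, [:c:]:] = [:[:c:]:] * x3 + [:U:]" by simp
  then have "[:U, [:c:]:] = ?\<psi> (lead_coeff (\<delta> X2) ^ N * X3 + s)"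
    by (simp only: rhom_add[OF \<psi>(1)] rhom_mult[OF \<psi>(1)] c U \<psi>x)
  then have F: "e [:U, [:c:]:] = [:[:U, [:c:]:]:]"
    using s(2) by (simp add: e_inv \<psi>\<theta> invariants_def)
  have \<theta>_UNIV: "adjoin scalars (\<theta> ` G) = UNIV" if G: "adjoin scalars G = UNIV" for G
  proof -
    have "\<theta> b \<in> adjoin scalars (\<theta> ` G)" for b
    proof (rule adjoin_scalars_image[OF \<theta>(1) _ adjoin_subring])
      show "\<theta> (const3 a) \<in> adjoin scalars (\<theta> ` G)" for a
        unfolding \<theta>x by (intro adjoin_base) (simp add: scalars_const3)
      show "b \<in> adjoin scalars G" using G by simp
    qed (auto intro: adjoin_gen)
    then show ?thesis using \<psi>\<theta>(2) by (metis UNIV_eq_I)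
  qed
  have \<psi>_coord: "adjoin scalars {?\<psi> X, ?\<psi> Y, ?\<psi> Z} = UNIV"
  proof -
    have "?\<psi> b \<in> adjoin scalars {?\<psi> X, ?\<psi> Y, ?\<psi> Z}" for b
    proof (rule adjoin_scalars_image[OF \<psi>(1) _ adjoin_subring])
      show "?\<psi> (const3 a) \<in> adjoin scalars {?\<psi> X, ?\<psi> Y, ?\<psi> Z}" for a
        unfolding \<psi>x by (intro adjoin_base) (simp add: scalars_const3)
      show "b \<in> adjoin scalars {X, Y, Z}" using coord by simp
    qed (auto intro: adjoin_gen)
    then show ?thesis using \<psi>\<theta>(1) by (metis UNIV_eq_I)
  qed
  have "?\<psi> X \<in> range (\<lambda>a. [:[:a:]:]) \<or> (\<exists>F T. e F = [:F:] \<and> adjoin scalars {x1, F, T} = UNIV)"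
  proof (rule standard_coordinates_dichotomy[OF e _ _ _ c0 F \<psi>_coord])
    show "e (const3 a) = [:const3 a:]" for a unfolding e_inv \<theta>x by (rule scal)
    show "e x1 = [:x1:]" unfolding e_inv \<theta>x by (rule X1)
    show "degree (e x2) > 0" unfolding e_def degree_map_poly_inj[OF \<psi>] \<theta>x by (rule deg)
    show "e (?\<psi> X) = [:?\<psi> X:]" unfolding e_inv \<psi>\<theta> by (rule X)
  qed
  then show ?thesis
  proof
    assume "?\<psi> X \<in> range (\<lambda>a. [:[:a:]:])"
    then obtain a where "?\<psi> X = [:[:a:]:]" by blast
    then have "X = \<theta> [:[:a:]:]" using \<psi>\<theta>(2)[of X] by simp
    then show ?thesis using eval3_inner(1)[of X1 X2 X3 a] by (simp add: \<theta>_def)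
  next
    assume "\<exists>F T. e F = [:F:] \<and> adjoin scalars {x1, F, T} = UNIV"
    then obtain F T where "\<delta> (\<theta> F) = [:\<theta> F:]" "adjoin scalars {x1, F, T} = UNIV" by (auto simp: e_inv)
    then show ?thesis using \<theta>_UNIV[of "{x1, F, T}"] by (auto simp: \<theta>x)
  qed
qed

theorem proposition5p2:
  fixes \<delta> :: "'k::field poly poly poly \<Rightarrow> 'k poly poly poly poly"
    and X Y Z :: "'k poly poly poly"
  assumes "\<delta> \<in> EXP scalars"
    and "[X, Y, Z] \<in> adapted_coordinate_systems scalars 3 \<delta>"
  shows "triangular scalars 3 \<delta> \<longleftrightarrow> triangular (adjoin scalars {X}) 2 \<delta>"
proof -
  note \<delta> = assms(1)
  interpret exponential \<delta> by (rule EXP_scalars[OF \<delta>])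
  have coord: "adjoin scalars {X, Y, Z} = UNIV"
    using assms(2) by (simp add: adapted_coordinate_systems_def coordinate_systems_def)
  \<comment> \<open>If some system begins with two invariants, so does every adapted one; hence
    \<open>X\<close> and \<open>Y\<close> are invariant.\<close>
  have two: "triangular (adjoin scalars {X}) 2 \<delta>"
    if VW: "adjoin scalars {V, W, T} = UNIV" "\<delta> V = [:V:]" "\<delta> W = [:W:]" for V W T
  proof -
    have "set (take 2 [X, Y, Z]) \<subseteq> invariants \<delta>"
      by (rule adapted_maximal[OF \<delta> assms(2), of "[V, W, T]"])
        (use VW in \<open>auto simp: coordinate_systems_def invariants_def numeral_2_eq_2\<close>)
    then show ?thesis
      by (intro two_invariant_coordinates_triangular[OF \<delta> coord])
        (auto simp: invariants_def numeral_2_eq_2)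
  qed
  show ?thesis
  proof
    assume "triangular scalars 3 \<delta>"
    then obtain Xs where Xs: "length Xs = 3" "adjoin scalars (set Xs) = UNIV"
      and co: "\<And>i j. i < 3 \<Longrightarrow> coeff (\<delta> (Xs ! i) - [:Xs ! i:]) j \<in> adjoin scalars (set (take i Xs))"
      and sl: "\<And>i. i < 3 \<Longrightarrow> \<delta> (Xs ! i) \<noteq> [:Xs ! i:] \<Longrightarrow> \<forall>j<i. \<delta> (Xs ! j) = [:Xs ! j:] \<Longrightarrow>
        local_slice \<delta> (Xs ! i)"
      unfolding triangular_def coordinate_systems_def by blast
    obtain X1 X2 X3 where Xs_eq: "Xs = [X1, X2, X3]"
      using Xs(1) by (auto simp: numeral_3_eq_3 length_Suc_conv)
    have coord1: "adjoin scalars {X1, X2, X3} = UNIV" using Xs(2) Xs_eq by simp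
    have "adjoin scalars {} \<subseteq> (scalars :: 'k poly poly poly set)"
      using subring_range[OF rhom_const3] by (intro adjoin_least) (auto simp: scalars_const3)
    then have c1: "coeff (\<delta> X1 - [:X1:]) j \<in> scalars" for j using co[of 0 j] Xs_eq by auto
    have c2: "coeff (\<delta> X2 - [:X2:]) j \<in> adjoin scalars {X1}" for j using co[of 1 j] Xs_eq by simp
    have c3: "coeff (\<delta> X3 - [:X3:]) j \<in> adjoin scalars {X1, X2}" for j
      using co[of 2 j] Xs_eq by (simp add: numeral_2_eq_2)
    show "triangular (adjoin scalars {X}) 2 \<delta>"
    proof (cases "\<delta> X1 = [:X1:]")
      case False
      then have "local_slice \<delta> X1" using sl[of 0] Xs_eq by simp
      from moved_first_coordinate[OF \<delta> coord1 this c1 c2 c3] show ?thesis using two by blast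
    next
      case X1: True
      show ?thesis
      proof (cases "\<delta> X2 = [:X2:]")
        case True
        then show ?thesis using two[OF coord1 X1] by blast
      next
        case False
        then have slice: "local_slice \<delta> X2" using sl[of 1] Xs_eq X1 by simp
        have "set (take 1 [X, Y, Z]) \<subseteq> invariants \<delta>"
          by (rule adapted_maximal[OF \<delta> assms(2), of "[X1, X2, X3]"])
            (use coord1 X1 in \<open>auto simp: coordinate_systems_def invariants_def\<close>)
        then have X: "\<delta> X = [:X:]" by (simp add: invariants_def)
        from moved_second_coordinate[OF \<delta> coord1 X1 slice c2 c3 coord X] show ?thesis
        proof
          assume "\<exists>F T. \<delta> F = [:F:] \<and> adjoin scalars {X1, F, T} = UNIV"
          then show ?thesis using two X1 by blast
        next
          assume "X \<in> adjoin scalars {X1}"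
          \<comment> \<open>Over \<open>k[X] = k[X1]\<close> the given coordinates
            \<open>X2, X3\<close> already form a triangular system.\<close>
          then have eq: "adjoin scalars {X} = adjoin scalars {X1}"
            by (rule coordinate_in_univariate_subring[OF coord])
          have "[X2, X3] \<in> coordinate_systems (adjoin scalars {X}) 2"
            using coord1 unfolding eq by (simp add: coordinate_systems_def adjoin_adjoin)
          moreover have "coeff (\<delta> ([X2, X3] ! i) - [:[X2, X3] ! i:]) j
              \<in> adjoin (adjoin scalars {X}) (set (take i [X2, X3]))" if "i < 2" for i j
            using that c2[of j] c3[of j] unfolding eq
            by (cases i) (auto simp: less_Suc_eq adjoin_adjoin insert_commute)
          moreover have "coeff (\<delta> ([X2, X3] ! i) - [:[X2, X3] ! i:]) 0 = 0" for i
            by (simp add: coeff_0)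
          moreover have "local_slice \<delta> ([X2, X3] ! i)"
            if "i < 2" "\<forall>j<i. \<delta> ([X2, X3] ! j) = [:[X2, X3] ! j:]" for i
            using that slice False by (cases i) (auto simp: less_Suc_eq)
          ultimately show ?thesis
            unfolding triangular_def using EXP_adjoin_iff[OF \<delta>] X by blast
        qed
      qed
    qed
  next
    assume tri: "triangular (adjoin scalars {X}) 2 \<delta>"
    then have X: "\<delta> X = [:X:]" using EXP_adjoin_iff[OF \<delta>] unfolding triangular_def by blast
    obtain Xs where Xs: "length Xs = 2" "adjoin (adjoin scalars {X}) (set Xs) = UNIV"
      and co: "\<And>i j. i < 2 \<Longrightarrow>
        coeff (\<delta> (Xs ! i) - [:Xs ! i:]) j \<in> adjoin (adjoin scalars {X}) (set (take i Xs))"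
      and sl: "\<And>i. i < 2 \<Longrightarrow> \<delta> (Xs ! i) \<noteq> [:Xs ! i:] \<Longrightarrow> \<forall>j<i. \<delta> (Xs ! j) = [:Xs ! j:] \<Longrightarrow>
        local_slice \<delta> (Xs ! i)"
      using tri unfolding triangular_def coordinate_systems_def by blast
    \<comment> \<open>Prefixing the invariant \<open>X\<close> to a triangular system over
      \<open>k[X]\<close> gives one over \<open>k\<close>; the first moved index shifts by
      one.\<close>
    have "X # Xs \<in> coordinate_systems scalars 3"
      using Xs by (simp add: coordinate_systems_def adjoin_adjoin)
    moreover have "coeff (\<delta> ((X # Xs) ! i) - [:(X # Xs) ! i:]) j
        \<in> adjoin scalars (set (take i (X # Xs)))" if "i < 3" for i j
    proof (cases i)
      case 0
      then show ?thesis using X by (simp add: subring_0[OF adjoin_subring])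
    next
      case (Suc n)
      then show ?thesis using that co[of n j] by (simp add: adjoin_adjoin)
    qed
    moreover have "coeff (\<delta> ((X # Xs) ! i) - [:(X # Xs) ! i:]) 0 = 0" for i by (simp add: coeff_0)
    moreover have "local_slice \<delta> ((X # Xs) ! i)"
      if "i < 3" "\<delta> ((X # Xs) ! i) \<noteq> [:(X # Xs) ! i:]"
        "\<forall>j<i. \<delta> ((X # Xs) ! j) = [:(X # Xs) ! j:]" for i
    proof (cases i)
      case 0
      then show ?thesis using X that(2) by simp
    next
      case (Suc n)
      have "\<forall>j<n. \<delta> (Xs ! j) = [:Xs ! j:]" using that(3) Suc by fastforce
      then show ?thesis using that Suc sl[of n] by simp
    qed
    ultimately show "triangular scalars 3 \<delta>" unfolding triangular_def using \<delta> by blast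
  qed
qed

end
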